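(* Let $M=\mathbb O\mathrm H^2$, so that $n=16$, $p=8$, $q=7$. Put $x=\sinh^2r$ and $\delta=1-\beta-\gamma$. Then, at every point of $M\setminus\{o\}$ and for every unit normal $\nu=\alpha N+v+w$ there, with $\beta=|v|^2$, $\gamma=|w|^2$, $$\mathscr T_{8,7}=-\frac{\mathcal P^{\mathbb O}_x(\beta,\gamma)}{27225(1+x)^8},$$ where $$\mathcal P^{\mathbb O}_x=B_{20}\beta^2+B_{11}\beta\gamma+B_{02}\gamma^2+B_{10}\beta\delta+B_{01}\gamma\delta$$ and, with $L(x)=120x^3+396x^2+440x+165$, $$\begin{aligned} B_{20}={}&(1+x)L(x)(2520x^4+9972x^3+14828x^2+9845x+2475),\\ B_{11}={}&2L(x)(3600x^5+16944x^4+31752x^3+29568x^2+13640x+2475),\\ B_{02}={}&L(x)(4800x^5+21792x^4+39144x^3+34628x^2+14960x+2475),\\ B_{10}={}&288000x^8+2399040x^7+8774208x^6+18408720x^5+24235728x^4\\&+20497400x^3+10865800x^2+3294225x+435600,\\ B_{01}={}&8\bigl(64800x^8+512640x^7+1774992x^6+3511992x^5+4339236x^4\\&+3421880x^3+1675850x^2+462825x+54450\bigr). \end{aligned}$$ Consequently $$\mathscr T_{8,7}\le0,\qquad\mathscr T_{8,7}=0\iff\beta=\gamma=0.$$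
   Context: $M=\mathbb O\mathrm H^2$ is the Cayley hyperbolic plane (real dimension $n=16$), with metric $g$ normalized so that for every unit $\theta\in T_oM$ the radial curvature operator $X\mapsto R(X,\theta)\theta$ on $\theta^\perp$ has sectional-curvature eigenvalues $-1$ (multiplicity $p=8$) and $-4$ (multiplicity $q=7$). Fix $o\in M$; $\mathbb S_o^{15}\subset T_oM$ is the unit sphere with round metric and $T_\theta\mathbb S_o^{15}=\mathcal H_\theta\oplus\mathcal V_\theta$ is the orthogonal splitting into the $-1$ and $-4$ eigenspaces. In polar coordinates $(r,\theta)$ about $o$, $g=dr^2+\sinh^2r\,g_{\mathcal H}+\sinh^2r\cosh^2r\,g_{\mathcal V}$, with $g_{\mathcal H},g_{\mathcal V}$ the restrictions of the round metric. The volume radius $R(r)$ is defined by $R^{16}=16\int_0^r\sinh^{15}s\cosh^7s\,ds$. For $\varphi\in C^1(\mathbb S_o^{15})$ let $F_{t,\varphi}(R,\theta)=(e^{t\varphi(\theta)}R,\theta)$ in coordinates $(R,\theta)$ on $M\setminus\{o\}$. For a unit vector $\nu$ at a point of $M\setminus\{o\}$ write $\nu=\alpha N+v+w$ with $N=\partial_r$ and $v,w$ in the subspaces tangent to the geodesic sphere corresponding to $\mathcal H_\theta,\mathcal V_\theta$. With $\Pi=\nu^\perp$, put $J_\Pi(t,\varphi)=|\operatorname{cof}DF_{t,\varphi}\,\nu|$, $\operatorname{cof}L=(\det L)L^{-T}$ (with respect to $g$ at source and target), i.e. the $15$-dimensional Jacobian of $DF_{t,\varphi}|_\Pi$. With $\varphi_j(\theta)=\langle\theta,e_j\rangle$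 for an orthonormal basis $e_1,\dots,e_{16}$ of $T_oM$ and primes denoting $t$-derivatives, $$\mathscr T_{8,7}=\sum_{j=1}^{16}J_\Pi''(0,\varphi_j)-16\,J_\Pi'(0,1),$$ where $1$ denotes the constant function. *)

theory Defs
  imports "HOL-Analysis.Analysis"
begin

text \<open>The octonions are obtained from the complex numbers by applying the Cayley-Dickson doubling
  \<open>(a, b)(c, d) = (a c - d\<^sup>* b, d a + b c\<^sup>*)\<close>, \<open>(a, b)\<^sup>* = (a\<^sup>*, - b)\<close> twice. The inner product that
  the library puts on the iterated product type is \<open>Re (x y\<^sup>*)\<close>.\<close>

type_synonym quat = "complex \<times> complex"
type_synonym octo = "quat \<times> quat"

fun quat_conj :: "quat \<Rightarrow> quat" where
  "quat_conj (a, b) = (cnj a, - b)"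

fun quat_mult :: "quat \<Rightarrow> quat \<Rightarrow> quat" where
  "quat_mult (a, b) (c, d) = (a * c - cnj d * b, d * a + b * cnj c)"

fun octo_conj :: "octo \<Rightarrow> octo" where
  "octo_conj (p, q) = (quat_conj p, - q)"

fun octo_mult :: "octo \<Rightarrow> octo \<Rightarrow> octo" (infixl "\<odot>" 70) where
  "octo_mult (p, q) (r, s) =
     (quat_mult p r - quat_mult (quat_conj s) q, quat_mult s p + quat_mult q (quat_conj r))"

text \<open>The tangent space at the base point is the sum of two copies of the octonions, with its
  standard inner product. The Cayley hyperbolic plane is a Hadamard manifold, so the exponential map
  at the base point is a diffeomorphism, and the manifold itself is identified with this
  vector space: the point with polar coordinates \<open>(r, \<theta>)\<close> is \<open>r *\<^sub>R \<theta>\<close>, i.e. \<open>r = norm x\<close>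
  and \<open>\<theta> = sgn x\<close>. All tangent spaces are identified with the same vector space.\<close>

type_synonym cayley = "octo \<times> octo"

text \<open>The curvature tensor \<open>R(X, Y)Z\<close> at the base point (the formula of Brown and Gray), with
  the sign for which \<open>R(X, Y)Y \<bullet> X\<close> is the sectional curvature of orthonormal \<open>X, Y\<close>, and
  with sectional curvatures in \<open>[-4, -1]\<close>.\<close>

fun curv :: "cayley \<Rightarrow> cayley \<Rightarrow> cayley \<Rightarrow> cayley" where
  "curv (a, b) (c, d) (e, f) =
     (- ((4 * (c \<bullet> e)) *\<^sub>R a - (4 * (a \<bullet> e)) *\<^sub>R c
         + (e \<odot> octo_conj d) \<odot> b - (e \<odot> octo_conj b) \<odot> d
         + (a \<odot> octo_conj d - c \<odot> octo_conj b) \<odot> f),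
      - ((4 * (d \<bullet> f)) *\<^sub>R b - (4 * (b \<bullet> f)) *\<^sub>R d
         + (f \<odot> octo_conj c) \<odot> a - (f \<odot> octo_conj a) \<odot> c
         + (b \<odot> octo_conj c - d \<odot> octo_conj a) \<odot> e))"

definition Hsp :: "cayley \<Rightarrow> cayley set" where
  "Hsp \<theta> = {X. X \<bullet> \<theta> = 0 \<and> curv X \<theta> \<theta> = - X}"

definition Vsp :: "cayley \<Rightarrow> cayley set" where
  "Vsp \<theta> = {X. X \<bullet> \<theta> = 0 \<and> curv X \<theta> \<theta> = - (4 *\<^sub>R X)}"

definition oproj :: "cayley set \<Rightarrow> cayley \<Rightarrow> cayley" where
  "oproj S u = (THE p. p \<in> S \<and> (\<forall>s\<in>S. (u - p) \<bullet> s = 0))"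

text \<open>The metric \<open>dr\<^sup>2 + sinh\<^sup>2 r g\<^sub>H + sinh\<^sup>2 r cosh\<^sup>2 r g\<^sub>V\<close>. A tangent vector \<open>u\<close> at
  \<open>x = r *\<^sub>R \<theta>\<close> has \<open>dr(u) = u \<bullet> \<theta>\<close>, and \<open>d\<theta>(u)\<close> is the component of \<open>u\<close> orthogonal to
  \<open>\<theta>\<close> divided by \<open>r\<close>; this is where the denominators come from.\<close>

definition cayley_metric :: "cayley \<Rightarrow> cayley \<Rightarrow> cayley \<Rightarrow> real" where
  "cayley_metric x u v =
     (if x = 0 then u \<bullet> v
      else let r = norm x; \<theta> = sgn x in
        (u \<bullet> \<theta>) * (v \<bullet> \<theta>)
        + (sinh r / r)\<^sup>2 * (oproj (Hsp \<theta>) u \<bullet> oproj (Hsp \<theta>) v)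
        + (sinh r * cosh r / r)\<^sup>2 * (oproj (Vsp \<theta>) u \<bullet> oproj (Vsp \<theta>) v))"

text \<open>The radial field \<open>N = \<partial>\<^sub>r\<close>, defined away from the base point.\<close>

definition radial :: "cayley \<Rightarrow> cayley" where
  "radial x = sgn x"

text \<open>Determinants and Gram determinants are taken in an enumeration of the standard basis; they do
  not depend on it.\<close>

definition std_basis :: "16 \<Rightarrow> cayley" where
  "std_basis = (SOME b. bij_betw b UNIV Basis)"

definition lin_det :: "(cayley \<Rightarrow> cayley) \<Rightarrow> real" where
  "lin_det L = det (\<chi> i j. std_basis i \<bullet> L (std_basis j))"

definition gram_det :: "cayley \<Rightarrow> real" where
  "gram_det x = det (\<chi> i j. cayley_metric x (std_basis i) (std_basis j))"

text \<open>For linear \<open>L\<close> from the tangent space at \<open>x\<close> to the one at \<open>y\<close>: its determinant in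
  positively oriented orthonormal bases for the metric at \<open>x\<close> and \<open>y\<close>, its transpose (from
  the tangent space at \<open>y\<close> to the one at \<open>x\<close>), and its cofactor map.\<close>

definition metric_det :: "cayley \<Rightarrow> cayley \<Rightarrow> (cayley \<Rightarrow> cayley) \<Rightarrow> real" where
  "metric_det x y L = lin_det L * sqrt (gram_det y) / sqrt (gram_det x)"

definition metric_transpose ::
    "cayley \<Rightarrow> cayley \<Rightarrow> (cayley \<Rightarrow> cayley) \<Rightarrow> cayley \<Rightarrow> cayley" where
  "metric_transpose x y L = (THE A. \<forall>w u. cayley_metric x (A w) u = cayley_metric y w (L u))"

definition cof :: "cayley \<Rightarrow> cayley \<Rightarrow> (cayley \<Rightarrow> cayley) \<Rightarrow> cayley \<Rightarrow> cayley" where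
  "cof x y L u = metric_det x y L *\<^sub>R inv (metric_transpose x y L) u"

definition volume_radius :: "real \<Rightarrow> real" where
  "volume_radius r = root 16 (16 * integral {0..r} (\<lambda>s. sinh s ^ 15 * cosh s ^ 7))"

text \<open>\<open>F\<^sub>t\<^sub>,\<^sub>\<phi>\<close> is \<open>(R, \<theta>) \<mapsto> (exp (t \<phi>(\<theta>)) R, \<theta>)\<close> in terms of the volume radius \<open>R\<close>; only the
  values of \<open>\<phi>\<close> on the unit sphere matter.\<close>

definition deform :: "real \<Rightarrow> (cayley \<Rightarrow> real) \<Rightarrow> cayley \<Rightarrow> cayley" where
  "deform t \<phi> x =
     inv_into {0..} volume_radius (exp (t * \<phi> (sgn x)) * volume_radius (norm x)) *\<^sub>R sgn x"

text \<open>\<open>J\<^sub>\<Pi>(t, \<phi>)\<close> for the hyperplane \<open>\<Pi>\<close> with unit normal \<open>\<nu>\<close> at the point \<open>x\<close>.\<close>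

definition jac :: "cayley \<Rightarrow> cayley \<Rightarrow> (cayley \<Rightarrow> real) \<Rightarrow> real \<Rightarrow> real" where
  "jac x \<nu> \<phi> t =
     (let y = deform t \<phi> x; c = cof x y (frechet_derivative (deform t \<phi>) (at x)) \<nu>
      in sqrt (cayley_metric y c c))"

definition trace_T :: "(nat \<Rightarrow> cayley) \<Rightarrow> cayley \<Rightarrow> cayley \<Rightarrow> real" where
  "trace_T e x \<nu> =
     (\<Sum>j = 1..16. deriv (deriv (jac x \<nu> (\<lambda>\<theta>. \<theta> \<bullet> e j))) 0)
     - 16 * deriv (jac x \<nu> (\<lambda>_. 1)) 0"

definition Lpol :: "real \<Rightarrow> real" where
  "Lpol x = 120*x^3 + 396*x^2 + 440*x + 165"

definition B20 :: "real \<Rightarrow> real" where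
  "B20 x = (1 + x) * Lpol x * (2520*x^4 + 9972*x^3 + 14828*x^2 + 9845*x + 2475)"

definition B11 :: "real \<Rightarrow> real" where
  "B11 x = 2 * Lpol x * (3600*x^5 + 16944*x^4 + 31752*x^3 + 29568*x^2 + 13640*x + 2475)"

definition B02 :: "real \<Rightarrow> real" where
  "B02 x = Lpol x * (4800*x^5 + 21792*x^4 + 39144*x^3 + 34628*x^2 + 14960*x + 2475)"

definition B10 :: "real \<Rightarrow> real" where
  "B10 x = 288000*x^8 + 2399040*x^7 + 8774208*x^6 + 18408720*x^5 + 24235728*x^4
     + 20497400*x^3 + 10865800*x^2 + 3294225*x + 435600"

definition B01 :: "real \<Rightarrow> real" where
  "B01 x = 8 * (64800*x^8 + 512640*x^7 + 1774992*x^6 + 3511992*x^5 + 4339236*x^4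
     + 3421880*x^3 + 1675850*x^2 + 462825*x + 54450)"

definition Ppol :: "real \<Rightarrow> real \<Rightarrow> real \<Rightarrow> real" where
  "Ppol x \<beta> \<gamma> = (let \<delta> = 1 - \<beta> - \<gamma> in
     B20 x * \<beta>\<^sup>2 + B11 x * \<beta> * \<gamma> + B02 x * \<gamma>\<^sup>2 + B10 x * \<beta> * \<delta> + B01 x * \<gamma> * \<delta>)"

end

theory Submission
  imports Defs
begin

text \<open>
  Fix the direction \<open>\<theta>\<close> of the base point. All maps in play preserve rays, so the whole computation
  takes place at this single \<open>\<theta>\<close>, in the orthogonal splitting of the tangent space into
  the line of \<open>\<theta>\<close> and the two eigenspaces of the radial curvature operator. For \<open>\<theta> = (c, d)\<close> the octonionic
  line through \<open>\<theta>\<close> has an explicit orthogonal projection \<open>line_proj\<close>, of trace 8, and the curvature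
  operator is an affine expression in it (\<open>radial_curv\<close>). Hence the eigenspace for \<open>-4\<close> is the rest of
  that line, of dimension 7, and the eigenspace for \<open>-1\<close> is its complement, of dimension 8.

  In the underlying vector space the differential of the deformation is block triangular: it scales both
  eigenspaces by one factor, and only its radial row sees the gradient of \<open>\<phi>\<close>. So
  its transpose, cofactor map and determinant are explicit (\<open>cof_shear\<close>). The determinant is
  \<open>exp (16 t \<phi>)\<close>, because the 16th power of the volume radius is a multiple of the volume. The squared
  Jacobian becomes
  \<open>\<alpha>\<^sup>2 w\<^sub>N + w\<^sub>H |v - t \<alpha> k \<nabla>\<^sub>H \<phi>|\<^sup>2 + w\<^sub>V |w - t \<alpha> k \<nabla>\<^sub>V \<phi>|\<^sup>2\<close> with weights evaluated at \<open>t \<phi>(\<theta>)\<close>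
  (\<open>jac_polar\<close>).

  The volume integral is elementary: with \<open>X = sinh\<^sup>2 s\<close> one has \<open>R\<^sup>1\<^sup>6 = X\<^sup>8 L(X) / 165\<close>. Therefore
  \<open>X\<close>, followed along the dilation \<open>R \<mapsto> exp \<tau> R\<close>, solves an autonomous equation with a rational right-hand
  side, and the logarithmic derivatives of the three weights are rational functions of \<open>X\<close>. This gives
  the first two derivatives of the Jacobian at \<open>t = 0\<close> (\<open>jac_jet2\<close>).

  For the coordinate functions of an orthonormal basis, Parseval's identity evaluates all
  sums over the basis: \<open>\<Sum> \<phi>\<^sub>j\<^sup>2 = 1\<close>, \<open>\<Sum> \<phi>\<^sub>j \<nabla>\<phi>\<^sub>j = 0\<close>, and the sums of the squared gradients are the
  dimensions 8 and 7. What remains is an identity of rational functions, quadratic in \<open>\<beta>\<close>, \<open>\<gamma>\<close>, \<open>\<delta>\<close>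
  (\<open>trace_rational_identity\<close>). Since the coefficients of the resulting polynomial are positive for
  \<open>x > 0\<close>, the sign and the equality case follow (\<open>Ppol_sign\<close>).
\<close>

section \<open>Octonion identities\<close>

lemma octo_cases: obtains a b c d :: complex where "x = ((a, b), (c, d))"
  by (metis surj_pair)

lemma octo_mult_add_left: "(x + y) \<odot> z = x \<odot> z + y \<odot> z"
  by (cases x rule: octo_cases; cases y rule: octo_cases; cases z rule: octo_cases)
     (simp add: algebra_simps)

lemma octo_mult_add_right: "z \<odot> (x + y) = z \<odot> x + z \<odot> y"
  by (cases x rule: octo_cases; cases y rule: octo_cases; cases z rule: octo_cases)
     (simp add: algebra_simps)

lemma octo_mult_scaleR_right: "z \<odot> (t *\<^sub>R x) = t *\<^sub>R (z \<odot> x)"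
  by (cases x rule: octo_cases; cases z rule: octo_cases)
     (simp add: algebra_simps scaleR_conv_of_real)

lemma octo_conj_mult: "octo_conj (x \<odot> y) = octo_conj y \<odot> octo_conj x"
  by (cases x rule: octo_cases; cases y rule: octo_cases)
     (simp add: algebra_simps)

lemma octo_conj_conj: "octo_conj (octo_conj x) = x"
  by (cases x rule: octo_cases) simp

text \<open>This and the next two identities hold because the octonions are an alternative algebra with a multiplicative
  norm; from the components they are polynomial identities.\<close>

lemma octo_mult_adjoint: "(m \<odot> b) \<bullet> a = b \<bullet> (octo_conj m \<odot> a)"
  by (cases m rule: octo_cases; cases b rule: octo_cases; cases a rule: octo_cases)
     (simp add: inner_prod_def inner_complex_def algebra_simps)

lemma octo_conj_mult_cancel: "octo_conj m \<odot> (m \<odot> a) = (m \<bullet> m) *\<^sub>R a"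
  by (cases m rule: octo_cases; cases a rule: octo_cases)
     (simp add: inner_prod_def inner_complex_def complex_eq_iff power2_eq_square algebra_simps)

lemma octo_conj_mult_polarized: "(c \<odot> octo_conj d) \<odot> b + (c \<odot> octo_conj b) \<odot> d = (2 * (b \<bullet> d)) *\<^sub>R c"
  by (cases c rule: octo_cases; cases b rule: octo_cases; cases d rule: octo_cases)
     (simp add: inner_prod_def inner_complex_def complex_eq_iff algebra_simps)

text \<open>For a unit vector \<open>\<theta> = (c, d)\<close>, this is the orthogonal projection onto the octonionic line through \<open>\<theta>\<close>.
  If \<open>c \<noteq> 0\<close>, that line is the set of all \<open>(u, (d c\<^sup>-\<^sup>1) u)\<close>; the formula also covers \<open>c = 0\<close>.\<close>

fun line_proj :: "cayley \<Rightarrow> cayley \<Rightarrow> cayley" where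
  "line_proj (c, d) (a, b) =
     ((c \<bullet> c) *\<^sub>R a + (c \<odot> octo_conj d) \<odot> b, (d \<odot> octo_conj c) \<odot> a + (d \<bullet> d) *\<^sub>R b)"

lemma octo_conj_inner: "octo_conj x \<bullet> octo_conj x = x \<bullet> x"
  by (cases x rule: octo_cases) (simp add: inner_prod_def inner_complex_def)

section \<open>Orthonormal bases, traces and determinants\<close>

definition onb :: "'a::euclidean_space set \<Rightarrow> bool" where
  "onb B \<longleftrightarrow> pairwise orthogonal B \<and> (\<forall>b\<in>B. norm b = 1) \<and> span B = UNIV"

lemma onb_independent:
  fixes B :: "'a::euclidean_space set"
  assumes "onb B"
  shows "independent B" "finite B" "card B = DIM('a)"
proof -
  show ind: "independent B"
    using assms by (intro pairwise_orthogonal_independent) (auto simp: onb_def)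
  then show "finite B" by (rule independent_imp_finite)
  show "card B = DIM('a)"
    using indep_card_eq_dim_span[OF ind] assms by (metis dim_UNIV onb_def)
qed

lemma onbI_card:
  fixes B :: "'a::euclidean_space set"
  assumes "pairwise orthogonal B" "\<And>b. b \<in> B \<Longrightarrow> norm b = 1" "card B = DIM('a)"
  shows "onb B"
proof -
  have ind: "independent B"
    using assms by (intro pairwise_orthogonal_independent) (force+)
  then have "UNIV \<subseteq> span B"
    using card_eq_dim[of B UNIV] assms(3) independent_imp_finite by auto
  then show ?thesis using assms by (auto simp: onb_def)
qed

lemma onb_Basis: "onb (Basis :: 'a::euclidean_space set)"
  by (auto simp: onb_def pairwise_def orthogonal_def inner_Basis)

lemma onb_inner:
  assumes "onb B" "b \<in> B" "c \<in> B"
  shows "b \<bullet> c = (if b = c then 1 else 0)"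
  using assms by (auto simp: onb_def pairwise_def orthogonal_def norm_eq_1)

lemma parseval:
  assumes "onb B"
  shows "(\<Sum>b\<in>B. (u \<bullet> b) * (v \<bullet> b)) = u \<bullet> v"
proof -
  have "(\<Sum>b\<in>B. (v \<bullet> b) *\<^sub>R b) = v"
    using assms onb_independent[OF assms] by (intro orthonormal_basis_expand) (auto simp: onb_def)
  then have "u \<bullet> v = u \<bullet> (\<Sum>b\<in>B. (v \<bullet> b) *\<^sub>R b)" by simp
  also have "\<dots> = (\<Sum>b\<in>B. (u \<bullet> b) * (v \<bullet> b))"
    by (simp add: inner_sum_right mult.commute)
  finally show ?thesis by simp
qed

text \<open>Both sides are the Hilbert-Schmidt norm of \<open>P\<close>, and expanding \<open>P b\<close> in the other basis turns one
  into the other.\<close>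

lemma trace_selfadjoint_projection:
  assumes B: "onb B" and sa: "\<And>u v. P u \<bullet> v = u \<bullet> P v" and id: "\<And>u. P (P u) = P u"
  shows "(\<Sum>b\<in>B. b \<bullet> P b) = (\<Sum>b\<in>Basis. b \<bullet> P b)"
proof -
  have eq: "u \<bullet> P u = P u \<bullet> P u" for u by (metis sa id)
  have "(\<Sum>b\<in>B. b \<bullet> P b) = (\<Sum>b\<in>B. \<Sum>c\<in>Basis. (P b \<bullet> c) * (P b \<bullet> c))"
    by (simp add: eq parseval[OF onb_Basis])
  also have "\<dots> = (\<Sum>c\<in>Basis. \<Sum>b\<in>B. (P c \<bullet> b) * (P c \<bullet> b))"
    by (subst sum.swap) (intro sum.cong refl arg_cong2[where f = "(*)"]; metis sa inner_commute)
  also have "\<dots> = (\<Sum>c\<in>Basis. c \<bullet> P c)"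
    by (simp add: eq parseval[OF B])
  finally show ?thesis .
qed

text \<open>In the Leibniz formula a permutation that moves a point moves at least two, hence some row other than \<open>k\<close>;
  only the identity contributes.\<close>

lemma det_one_nontrivial_row:
  fixes A :: "real^'n^'n"
  assumes off: "\<And>i j. i \<noteq> k \<Longrightarrow> i \<noteq> j \<Longrightarrow> A $ i $ j = 0"
  shows "det A = (\<Prod>i\<in>UNIV. A $ i $ i)"
proof -
  have zero: "(\<Prod>i\<in>UNIV. A $ i $ p i) = 0" if p: "p permutes UNIV" "p \<noteq> id" for p
  proof -
    have "\<exists>i. i \<noteq> k \<and> p i \<noteq> i"
    proof (rule ccontr)
      assume "\<not> ?thesis"
      then have fix_p: "p i = i" if "i \<noteq> k" for i using that by blast
      moreover have "p k = k"
        using fix_p[of "p k"] p(1) by (metis permutes_inj injD)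
      ultimately have "p = id" by (metis eq_id_iff)
      then show False using p(2) by simp
    qed
    then obtain i where "i \<noteq> k" "p i \<noteq> i" by blast
    then have "A $ i $ p i = 0" using off by metis
    then show ?thesis by (meson UNIV_I finite prod_zero)
  qed
  have "det A = (\<Sum>p\<in>{p. p permutes UNIV}. of_int (sign p) * (\<Prod>i\<in>UNIV. A $ i $ p i))"
    by (simp add: det_def)
  also have "\<dots> = (\<Sum>p\<in>{id}. of_int (sign p) * (\<Prod>i\<in>UNIV. A $ i $ p i))"
    by (rule sum.mono_neutral_right) (auto simp: permutes_id zero finite_permutations)
  finally show ?thesis by (simp add: sign_id)
qed

lemma std_basis_bij: "bij_betw std_basis UNIV Basis"
proof -
  have "\<exists>b :: 16 \<Rightarrow> cayley. bij_betw b UNIV Basis"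
    by (rule finite_same_card_bij) simp_all
  then show ?thesis unfolding std_basis_def by (rule someI_ex)
qed

text \<open>Orthonormal bases differ by an orthogonal matrix, which conjugates the matrix of \<open>L\<close> and leaves its
  determinant unchanged. This lets determinants be read off in a basis adapted to \<open>L\<close>.\<close>

lemma lin_det_onb:
  assumes B: "onb B" and L: "linear L" and k: "k \<in> B"
    and off: "\<And>b c. b \<in> B \<Longrightarrow> c \<in> B \<Longrightarrow> b \<noteq> k \<Longrightarrow> b \<noteq> c \<Longrightarrow> b \<bullet> L c = 0"
  shows "lin_det L = (\<Prod>b\<in>B. b \<bullet> L b)"
proof -
  obtain f :: "16 \<Rightarrow> cayley" where f: "bij_betw f UNIV B"
    using finite_same_card_bij[of "UNIV :: 16 set" B] onb_independent[OF B] by auto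
  define O1 :: "real^16^16" where "O1 = (\<chi> i j. f i \<bullet> std_basis j)"
  define A :: "real^16^16" where "A = (\<chi> i j. std_basis i \<bullet> L (std_basis j))"
  define A' :: "real^16^16" where "A' = (\<chi> i j. f i \<bullet> L (f j))"
  have sum_std: "(\<Sum>i\<in>UNIV. (u \<bullet> std_basis i) * (v \<bullet> std_basis i)) = u \<bullet> v" for u v
    using sum.reindex_bij_betw[OF std_basis_bij, of "\<lambda>b. (u \<bullet> b) * (v \<bullet> b)"] parseval[OF onb_Basis]
    by simp
  have inj_f: "f i = f j \<longleftrightarrow> i = j" for i j using f by (auto simp: bij_betw_def inj_on_def)
  have fB: "f i \<in> B" for i using f by (auto simp: bij_betw_def)
  have "O1 ** transpose O1 = mat 1"
    by (simp add: vec_eq_iff O1_def matrix_matrix_mult_def transpose_def mat_def sum_std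
        onb_inner[OF B fB fB] inj_f)
  then have "det O1 * det O1 = 1"
    by (metis det_I det_mul det_transpose)
  moreover have "A' = O1 ** A ** transpose O1"
  proof -
    have expand: "(\<Sum>i\<in>UNIV. (u \<bullet> std_basis i) *\<^sub>R std_basis i) = u" for u
      using sum.reindex_bij_betw[OF std_basis_bij, of "\<lambda>b. (u \<bullet> b) *\<^sub>R b"]
      by (simp add: euclidean_representation)
    have conj: "u \<bullet> L v = (\<Sum>k\<in>UNIV. (\<Sum>l\<in>UNIV. (u \<bullet> std_basis l) * (std_basis l \<bullet> L (std_basis k)))
              * (v \<bullet> std_basis k))" for u v
    proof -
      have "u \<bullet> L v = u \<bullet> L (\<Sum>k\<in>UNIV. (v \<bullet> std_basis k) *\<^sub>R std_basis k)"
        by (simp only: expand)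
      also have "\<dots> = (\<Sum>k\<in>UNIV. (v \<bullet> std_basis k) * (u \<bullet> L (std_basis k)))"
        by (simp add: linear_sum[OF L] linear_cmul[OF L] inner_sum_right)
      also have "\<dots> = (\<Sum>k\<in>UNIV. (\<Sum>l\<in>UNIV. (u \<bullet> std_basis l) * (L (std_basis k) \<bullet> std_basis l))
              * (v \<bullet> std_basis k))"
        by (simp only: sum_std mult.commute)
      finally show ?thesis by (simp only: inner_commute[of "L _"])
    qed
    show ?thesis
      unfolding vec_eq_iff A'_def A_def O1_def matrix_matrix_mult_def transpose_def vec_lambda_beta
      by (intro allI conj)
  qed
  ultimately have "det A' = det A"
    by (simp add: det_mul)
  also have "det A = lin_det L" by (simp add: A_def lin_det_def)
  finally have "lin_det L = det A'" ..
  also obtain i0 where "f i0 = k" using f k by (metis bij_betw_iff_bijections)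
  then have "det A' = (\<Prod>i\<in>UNIV. A' $ i $ i)"
    by (intro det_one_nontrivial_row[of i0]) (auto simp: A'_def intro!: off fB simp: inj_f)
  also have "\<dots> = (\<Prod>b\<in>B. b \<bullet> L b)"
    using prod.reindex_bij_betw[OF f, of "\<lambda>b. b \<bullet> L b"] by (simp add: A'_def)
  finally show ?thesis .
qed

section \<open>The eigenspaces of the radial curvature operator\<close>

lemma linear_line_proj: "linear (line_proj \<theta>)"
proof (rule linearI)
  fix u v :: cayley and r :: real
  obtain c d a b a' b' where eq: "\<theta> = (c, d)" "u = (a, b)" "v = (a', b')" by (metis surj_pair)
  show "line_proj \<theta> (u + v) = line_proj \<theta> u + line_proj \<theta> v"
    by (simp add: eq octo_mult_add_right algebra_simps)
  show "line_proj \<theta> (r *\<^sub>R u) = r *\<^sub>R line_proj \<theta> u"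
    by (simp add: eq octo_mult_scaleR_right algebra_simps)
qed

lemma line_proj_selfadjoint: "line_proj \<theta> u \<bullet> v = u \<bullet> line_proj \<theta> v"
proof -
  obtain c d a b a' b' where eq: "\<theta> = (c, d)" "u = (a, b)" "v = (a', b')" by (metis surj_pair)
  show ?thesis by (simp add: eq inner_add_left inner_add_right octo_mult_adjoint octo_conj_mult octo_conj_conj)
qed

lemma norm_one_pair: "norm (c, d) = 1 \<longleftrightarrow> c \<bullet> c + d \<bullet> (d::octo) = 1"
  by (simp add: norm_eq_1 inner_Pair)

lemma octo_mult_norm: "(x \<odot> y) \<bullet> (x \<odot> y) = (x \<bullet> x) * (y \<bullet> y)"
  by (simp add: octo_mult_adjoint octo_conj_mult_cancel)

lemma octo_alt: "(x \<odot> octo_conj d) \<odot> d = (d \<bullet> d) *\<^sub>R x"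
proof -
  have "(2::real) *\<^sub>R ((x \<odot> octo_conj d) \<odot> d) = (2::real) *\<^sub>R ((d \<bullet> d) *\<^sub>R x)"
    using octo_conj_mult_polarized[of x d d] by (simp add: scaleR_2)
  then show ?thesis by (simp only: scaleR_cancel_left) simp
qed

text \<open>With \<open>m = c d\<^sup>*\<close>, the projection has the matrix of entries \<open>|c|\<^sup>2\<close>, \<open>m\<close>, \<open>m\<^sup>*\<close>, \<open>|d|\<^sup>2\<close>. Alternativity and
  \<open>|m|\<^sup>2 = |c|\<^sup>2 |d|\<^sup>2\<close> let it be squared as if the entries were complex numbers.\<close>

lemma line_proj_idem:
  assumes "norm \<theta> = 1" shows "line_proj \<theta> (line_proj \<theta> u) = line_proj \<theta> u"
proof -
  obtain c d a b where eq: "\<theta> = (c, d)" "u = (a, b)" by (metis surj_pair)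
  have cd: "c \<bullet> c + d \<bullet> d = 1" using assms by (simp add: eq norm_one_pair)
  let ?m = "c \<odot> octo_conj d"
  have m: "d \<odot> octo_conj c = octo_conj ?m" by (simp add: octo_conj_mult octo_conj_conj)
  have n: "?m \<bullet> ?m = (c \<bullet> c) * (d \<bullet> d)" by (simp add: octo_mult_norm octo_conj_inner)
  have 1: "octo_conj ?m \<odot> (?m \<odot> b) = ((c \<bullet> c) * (d \<bullet> d)) *\<^sub>R b" for b
    by (simp only: octo_conj_mult_cancel n)
  have 2: "?m \<odot> (octo_conj ?m \<odot> a) = ((c \<bullet> c) * (d \<bullet> d)) *\<^sub>R a"
    using octo_conj_mult_cancel[of "octo_conj ?m" a] by (simp only: octo_conj_conj octo_conj_inner n)
  have d: "d \<bullet> d = 1 - c \<bullet> c" using cd by simp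
  show ?thesis
    unfolding eq line_proj.simps m octo_mult_add_right octo_mult_scaleR_right 1 2 d by (simp add: algebra_simps)
qed

lemma line_proj_self: assumes "norm \<theta> = 1" shows "line_proj \<theta> \<theta> = \<theta>"
proof -
  obtain c d where eq: "\<theta> = (c, d)" by (metis surj_pair)
  have cd: "c \<bullet> c + d \<bullet> d = 1" using assms by (simp add: eq norm_one_pair)
  show ?thesis
    using cd by (simp add: eq octo_alt flip: scaleR_left_distrib)
qed

lemma line_proj_trace: assumes "norm \<theta> = 1" shows "(\<Sum>b\<in>Basis. b \<bullet> line_proj \<theta> b) = 8"
proof -
  obtain c d where eq: "\<theta> = (c, d)" by (metis surj_pair)
  have cd: "c \<bullet> c + d \<bullet> d = 1" using assms by (simp add: eq norm_one_pair)
  have z: "x \<odot> 0 = 0" for x using octo_mult_scaleR_right[of x 0 0] by simp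
  have "(\<Sum>b\<in>Basis. b \<bullet> line_proj \<theta> b) = (\<Sum>b\<in>(Basis::octo set). c \<bullet> c) + (\<Sum>b\<in>(Basis::octo set). d \<bullet> d)"
    unfolding Basis_prod_def[where 'a=octo and 'b=octo]
    by (subst sum.union_disjoint)
       (auto simp: sum.reindex inj_on_def eq inner_Pair z inner_same_Basis simp del: DIM_prod)
  also have "\<dots> = 8 * (c \<bullet> c + d \<bullet> d)" by simp
  finally show ?thesis using cd by simp
qed

lemma octo_mult_diff_left: "(x - y) \<odot> z = x \<odot> z - y \<odot> z"
  using octo_mult_add_left[of "x - y" y z] by simp

text \<open>The linear bookkeeping in each of the two components of \<open>radial_curv\<close>, with \<open>s = |c|\<^sup>2\<close> and
  \<open>1 - s = |d|\<^sup>2\<close>, or the other way round.\<close>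

lemma radial_curv_collect:
  fixes a c y :: "'a::real_inner"
  shows "- ((4 * s) *\<^sub>R a - (4 * p) *\<^sub>R c + y - ((2 * q) *\<^sub>R c - y) + ((1 - s) *\<^sub>R a - ((2 * q) *\<^sub>R c - y)))
    = - (a + 3 *\<^sub>R (s *\<^sub>R a + y) - (4 * (p + q)) *\<^sub>R c)"
  by (rule vector_eq_ldot[THEN iffD1]) (simp add: inner_simps algebra_simps)

lemma radial_curv: assumes "norm \<theta> = 1"
  shows "curv X \<theta> \<theta> = - (X + 3 *\<^sub>R line_proj \<theta> X - (4 * (X \<bullet> \<theta>)) *\<^sub>R \<theta>)"
proof -
  obtain c d a b where eq: "\<theta> = (c, d)" "X = (a, b)" by (metis surj_pair)
  have d: "d \<bullet> d = 1 - c \<bullet> c" using assms by (simp add: eq norm_one_pair)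
  \<comment> \<open>Polarized alternativity rewrites every product in terms of those that occur in the projection.\<close>
  have 1: "(c \<odot> octo_conj b) \<odot> d = (2 * (b \<bullet> d)) *\<^sub>R c - (c \<odot> octo_conj d) \<odot> b"
    using octo_conj_mult_polarized[of c d b] by (simp add: algebra_simps)
  have 2: "(d \<odot> octo_conj a) \<odot> c = (2 * (a \<bullet> c)) *\<^sub>R d - (d \<odot> octo_conj c) \<odot> a"
    using octo_conj_mult_polarized[of d c a] by (simp add: algebra_simps)
  show ?thesis
    unfolding eq curv.simps line_proj.simps octo_mult_diff_left octo_alt 1 2 inner_Pair d
    unfolding add_Pair scaleR_Pair diff_Pair uminus_Pair prod.inject
    using radial_curv_collect[of "c \<bullet> c" a "a \<bullet> c" c "(c \<odot> octo_conj d) \<odot> b" "b \<bullet> d"]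
      radial_curv_collect[of "1 - c \<bullet> c" b "b \<bullet> d" d "(d \<odot> octo_conj c) \<odot> a" "a \<bullet> c"]
    by (simp only: add.commute[of "a \<bullet> c" "b \<bullet> d"]
        add.commute[of "(d \<odot> octo_conj c) \<odot> a" "(1 - c \<bullet> c) *\<^sub>R b"] inner_commute d diff_diff_eq2 add_diff_cancel_left' simp_thms)
qed

text \<open>The projections onto the two eigenspaces: \<open>Hproj\<close> onto the complement of the octonionic line through \<open>\<theta>\<close>,
  \<open>Vproj\<close> onto the part of that line orthogonal to \<open>\<theta>\<close>.\<close>

definition Hproj :: "cayley \<Rightarrow> cayley \<Rightarrow> cayley" where "Hproj \<theta> u = u - line_proj \<theta> u"

definition Vproj :: "cayley \<Rightarrow> cayley \<Rightarrow> cayley" where "Vproj \<theta> u = line_proj \<theta> u - (u \<bullet> \<theta>) *\<^sub>R \<theta>"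

lemma linear_Hproj: "linear (Hproj \<theta>)"
  unfolding Hproj_def by (intro linear_compose_sub linear_line_proj linear_ident)

lemma linear_Vproj: "linear (Vproj \<theta>)"
  unfolding Vproj_def
  by (intro linear_compose_sub linear_line_proj linearI) (simp_all add: inner_add_left scaleR_left_distrib)

context
  fixes \<theta> :: cayley assumes unit: "norm \<theta> = 1"
begin

lemma theta_sq: "\<theta> \<bullet> \<theta> = 1" using unit by (simp add: norm_eq_1)

lemma line_proj_theta: "line_proj \<theta> u \<bullet> \<theta> = u \<bullet> \<theta>"
  by (simp add: line_proj_selfadjoint line_proj_self unit)

lemma Hproj_theta: "Hproj \<theta> \<theta> = 0" "Hproj \<theta> u \<bullet> \<theta> = 0"
  by (simp_all add: Hproj_def line_proj_self unit line_proj_theta inner_diff_left)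

lemma Vproj_theta: "Vproj \<theta> \<theta> = 0" "Vproj \<theta> u \<bullet> \<theta> = 0"
  by (simp_all add: Vproj_def line_proj_self unit line_proj_theta inner_diff_left theta_sq)

lemma decompose: "u = (u \<bullet> \<theta>) *\<^sub>R \<theta> + Hproj \<theta> u + Vproj \<theta> u"
  by (simp add: Hproj_def Vproj_def)

lemma HV_compose: "Hproj \<theta> (Hproj \<theta> u) = Hproj \<theta> u" "Hproj \<theta> (Vproj \<theta> u) = 0"
  "Vproj \<theta> (Hproj \<theta> u) = 0" "Vproj \<theta> (Vproj \<theta> u) = Vproj \<theta> u"
  using linear_line_proj[of \<theta>]
  by (simp_all add: Hproj_def Vproj_def linear_diff linear_cmul line_proj_idem line_proj_self unit
      inner_diff_left line_proj_theta theta_sq)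

lemma Hproj_selfadjoint: "Hproj \<theta> u \<bullet> v = u \<bullet> Hproj \<theta> v"
  by (simp add: Hproj_def inner_diff_left inner_diff_right line_proj_selfadjoint)

lemma Vproj_selfadjoint: "Vproj \<theta> u \<bullet> v = u \<bullet> Vproj \<theta> v"
  by (simp add: Vproj_def inner_diff_left inner_diff_right line_proj_selfadjoint)
     (simp add: inner_commute)

lemma HV_inner: "Hproj \<theta> u \<bullet> Vproj \<theta> v = 0" "Vproj \<theta> u \<bullet> Hproj \<theta> v = 0"
  by (simp_all add: Hproj_selfadjoint Vproj_selfadjoint HV_compose)

lemma Hsp_iff: "u \<in> Hsp \<theta> \<longleftrightarrow> Hproj \<theta> u = u"
proof
  assume "u \<in> Hsp \<theta>"
  then have *: "u \<bullet> \<theta> = 0 \<and> - (u + 3 *\<^sub>R line_proj \<theta> u - (4 * (u \<bullet> \<theta>)) *\<^sub>R \<theta>) = - u"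
    unfolding Hsp_def mem_Collect_eq radial_curv[OF unit] .
  then have "3 *\<^sub>R line_proj \<theta> u = 0" by (elim conjE) simp
  then show "Hproj \<theta> u = u" by (simp add: Hproj_def)
next
  assume u: "Hproj \<theta> u = u"
  then have "line_proj \<theta> u = 0" by (simp add: Hproj_def)
  moreover have "u \<bullet> \<theta> = 0" using Hproj_theta(2)[of u] u by simp
  ultimately show "u \<in> Hsp \<theta>" by (simp add: Hsp_def radial_curv unit)
qed

lemma Vsp_iff: "u \<in> Vsp \<theta> \<longleftrightarrow> Vproj \<theta> u = u"
proof
  assume u: "u \<in> Vsp \<theta>"
  then have *: "u \<bullet> \<theta> = 0 \<and> - (u + 3 *\<^sub>R line_proj \<theta> u - (4 * (u \<bullet> \<theta>)) *\<^sub>R \<theta>) = - (4 *\<^sub>R u)"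
    unfolding Vsp_def mem_Collect_eq radial_curv[OF unit] .
  then have "- (u + 3 *\<^sub>R line_proj \<theta> u) = - ((1 + 3) *\<^sub>R u)" by (elim conjE) simp
  then have "u + 3 *\<^sub>R line_proj \<theta> u = (1 + 3) *\<^sub>R u" by (simp only: neg_equal_iff_equal)
  then have "3 *\<^sub>R line_proj \<theta> u = 3 *\<^sub>R u" by (simp only: scaleR_left_distrib scaleR_one add_left_cancel)
  then show "Vproj \<theta> u = u" using u by (simp add: Vproj_def Vsp_def)
next
  assume u: "Vproj \<theta> u = u"
  moreover have "u \<bullet> \<theta> = 0" using Vproj_theta(2)[of u] u by simp
  ultimately have "line_proj \<theta> u = u" "u \<bullet> \<theta> = 0" by (simp_all add: Vproj_def)
  then show "u \<in> Vsp \<theta>" by (simp add: Vsp_def radial_curv unit scaleR_left_distrib[of 1 3 u, simplified])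
qed

text \<open>Two vectors that satisfy the defining condition differ by an element of \<open>S\<close> that is orthogonal to itself.\<close>

lemma oproj_eqI:
  assumes "p \<in> S" "\<And>s. s \<in> S \<Longrightarrow> (u - p) \<bullet> s = 0" "\<And>q. q \<in> S \<Longrightarrow> p - q \<in> S"
  shows "oproj S u = p"
  unfolding oproj_def
proof (rule the_equality)
  show "p \<in> S \<and> (\<forall>s\<in>S. (u - p) \<bullet> s = 0)" using assms by blast
  fix q assume q: "q \<in> S \<and> (\<forall>s\<in>S. (u - q) \<bullet> s = 0)"
  then have "(p - q) \<bullet> (p - q) = (u - q) \<bullet> (p - q) - (u - p) \<bullet> (p - q)"
    by (simp add: algebra_simps)
  also have "\<dots> = 0" using q assms by simp
  finally show "q = p" by simp
qed

lemma oproj_Hsp: "oproj (Hsp \<theta>) u = Hproj \<theta> u"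
  by (rule oproj_eqI)
     (auto simp: Hsp_iff HV_compose linear_diff[OF linear_Hproj] inner_diff_left Hproj_selfadjoint)

lemma oproj_Vsp: "oproj (Vsp \<theta>) u = Vproj \<theta> u"
  by (rule oproj_eqI)
     (auto simp: Vsp_iff HV_compose linear_diff[OF linear_Vproj] inner_diff_left Vproj_selfadjoint)

end

section \<open>The polar metric and cofactors\<close>

text \<open>The shape of all linear maps that occur: diagonal for the splitting at \<open>\<theta>\<close>, except for a linear form
  \<open>m\<close> added to the radial component. With \<open>m = 0\<close> it also represents the metric itself.\<close>

definition shear :: "cayley \<Rightarrow> real \<Rightarrow> cayley \<Rightarrow> real \<Rightarrow> real \<Rightarrow> cayley \<Rightarrow> cayley" where
  "shear \<theta> a m b c u = (a * (u \<bullet> \<theta>) + m \<bullet> u) *\<^sub>R \<theta> + b *\<^sub>R Hproj \<theta> u + c *\<^sub>R Vproj \<theta> u"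

lemma linear_shear: "linear (shear \<theta> a m b c)"
  by (rule linearI)
     (simp_all add: shear_def linear_add[OF linear_Hproj] linear_add[OF linear_Vproj]
       linear_cmul[OF linear_Hproj] linear_cmul[OF linear_Vproj] inner_add_left inner_add_right
       distrib_left scaleR_add_left scaleR_add_right mult.left_commute mult.commute)

lemma subspace_fixed: assumes "linear f" shows "subspace {u. f u = u}"
  unfolding subspace_def using assms by (auto simp: linear_0 linear_add linear_cmul)

context
  fixes \<theta> :: cayley assumes unit: "norm \<theta> = 1"
begin

text \<open>The dimensions 8 and 7 come from the trace of the projection onto the octonionic line: 8 on the whole
  line, one of which is taken by \<open>\<theta>\<close>.\<close>

lemma adapted_onb:
  obtains BH BV where "onb (insert \<theta> (BH \<union> BV))" "finite BH" "finite BV"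
    "\<theta> \<notin> BH \<union> BV" "BH \<inter> BV = {}" "card BH = 8" "card BV = 7"
    "\<And>u. u \<in> BH \<Longrightarrow> Hproj \<theta> u = u" "\<And>u. u \<in> BV \<Longrightarrow> Vproj \<theta> u = u"
proof -
  obtain BH where BH: "BH \<subseteq> {u. Hproj \<theta> u = u}" "pairwise orthogonal BH"
    "\<And>x. x \<in> BH \<Longrightarrow> norm x = 1" "independent BH" "card BH = dim {u. Hproj \<theta> u = u}" "span BH = {u. Hproj \<theta> u = u}"
    by (rule orthonormal_basis_subspace[OF subspace_fixed[OF linear_Hproj[of \<theta>]]]) (rule that)
  obtain BV where BV: "BV \<subseteq> {u. Vproj \<theta> u = u}" "pairwise orthogonal BV"
    "\<And>x. x \<in> BV \<Longrightarrow> norm x = 1" "independent BV" "card BV = dim {u. Vproj \<theta> u = u}" "span BV = {u. Vproj \<theta> u = u}"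
    by (rule orthonormal_basis_subspace[OF subspace_fixed[OF linear_Vproj[of \<theta>]]]) (rule that)
  have fin: "finite BH" "finite BV" by (rule independent_imp_finite, fact)+
  have BHp: "Hproj \<theta> u = u" if "u \<in> BH" for u using BH(1) that by blast
  have BVp: "Vproj \<theta> u = u" if "u \<in> BV" for u using BV(1) that by blast
  have HT: "u \<bullet> \<theta> = 0" if "u \<in> BH" for u using Hproj_theta(2)[OF unit, of u] BHp[OF that] by simp
  have VT: "u \<bullet> \<theta> = 0" if "u \<in> BV" for u using Vproj_theta(2)[OF unit, of u] BVp[OF that] by simp
  have HV0: "u \<bullet> v = 0" if "u \<in> BH" "v \<in> BV" for u v
    using HV_inner(1)[OF unit, of u v] BHp[OF that(1)] BVp[OF that(2)] by simp
  have notin: "\<theta> \<notin> BH \<union> BV" using HT VT theta_sq[OF unit] by (metis UnE zero_neq_one)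
  have disj: "BH \<inter> BV = {}"
  proof (rule ccontr)
    assume "BH \<inter> BV \<noteq> {}"
    then obtain u where "u \<in> BH" "u \<in> BV" by blast
    then have "u \<bullet> u = 0" "norm u = 1" using HV0 BH(3) by blast+
    then show False by simp
  qed
  have onb: "onb (insert \<theta> (BH \<union> BV))"
    unfolding onb_def
  proof (intro conjI)
    show "pairwise orthogonal (insert \<theta> (BH \<union> BV))"
      using BH(2) BV(2) HT VT HV0
      unfolding pairwise_def orthogonal_def by (metis UnE inner_commute insertE)
    show "\<forall>b\<in>insert \<theta> (BH \<union> BV). norm b = 1" using BH(3) BV(3) unit by blast
    have "u \<in> span (insert \<theta> (BH \<union> BV))" for u
    proof -
      have "(u \<bullet> \<theta>) *\<^sub>R \<theta> \<in> span (insert \<theta> (BH \<union> BV))"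
        by (intro span_scale span_base) simp
      moreover have "Hproj \<theta> u \<in> span BH" using BH(6) HV_compose(1)[OF unit] by blast
      then have "Hproj \<theta> u \<in> span (insert \<theta> (BH \<union> BV))"
        using span_mono[of BH "insert \<theta> (BH \<union> BV)"] by auto
      moreover have "Vproj \<theta> u \<in> span BV" using BV(6) HV_compose(4)[OF unit] by blast
      then have "Vproj \<theta> u \<in> span (insert \<theta> (BH \<union> BV))"
        using span_mono[of BV "insert \<theta> (BH \<union> BV)"] by auto
      ultimately show ?thesis
        using decompose[OF unit, of u] span_add by metis
    qed
    then show "span (insert \<theta> (BH \<union> BV)) = UNIV" by blast
  qed
  have "card (insert \<theta> (BH \<union> BV)) = 16" using onb_independent(3)[OF onb] by simp
  then have sum: "card BH + card BV = 15"
    using fin notin disj by (simp add: card_Un_disjoint)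
  have lpH: "line_proj \<theta> u = 0" if "u \<in> BH" for u
    using BHp[OF that] by (simp add: Hproj_def)
  have lpV: "line_proj \<theta> u = u" if "u \<in> BV" for u
    using BVp[OF that] VT[OF that] by (simp add: Vproj_def)
  \<comment> \<open>The projection fixes \<open>\<theta>\<close> and \<open>BV\<close> and kills \<open>BH\<close>, so its trace 8 is \<open>1 + card BV\<close>.\<close>
  have "8 = (\<Sum>b\<in>insert \<theta> (BH \<union> BV). b \<bullet> line_proj \<theta> b)"
    using trace_selfadjoint_projection[OF onb, of "line_proj \<theta>"] line_proj_trace[OF unit]
    by (simp add: line_proj_selfadjoint line_proj_idem unit)
  also have "\<dots> = 1 + (\<Sum>b\<in>BH. b \<bullet> line_proj \<theta> b) + (\<Sum>b\<in>BV. b \<bullet> line_proj \<theta> b)"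
    using fin notin disj
    by (simp add: sum.union_disjoint line_proj_self unit theta_sq)
  also have "\<dots> = 1 + real (card BV)"
    using BV(3) by (simp add: lpH lpV norm_eq_1)
  finally have "card BV = 7" by simp
  with sum have "card BH = 8" by simp
  from that[OF onb fin notin disj this \<open>card BV = 7\<close> BHp BVp] show ?thesis .
qed

text \<open>In an adapted basis only the row of \<open>\<theta>\<close> has entries off the diagonal.\<close>

lemma lin_det_shear:
  assumes "m \<bullet> \<theta> = 0"
  shows "lin_det (shear \<theta> a m b c) = a * b ^ 8 * c ^ 7"
proof -
  obtain BH BV where B: "onb (insert \<theta> (BH \<union> BV))" "finite BH" "finite BV"
    "\<theta> \<notin> BH \<union> BV" "BH \<inter> BV = {}" "card BH = 8" "card BV = 7"
    "\<And>u. u \<in> BH \<Longrightarrow> Hproj \<theta> u = u" "\<And>u. u \<in> BV \<Longrightarrow> Vproj \<theta> u = u"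
    by (rule adapted_onb) blast
  let ?B = "insert \<theta> (BH \<union> BV)"
  have VH: "Vproj \<theta> u = 0" if "u \<in> BH" for u using HV_compose(3)[OF unit, of u] B(8)[OF that] by simp
  have HV: "Hproj \<theta> u = 0" if "u \<in> BV" for u using HV_compose(2)[OF unit, of u] B(9)[OF that] by simp
  have orth: "u \<bullet> v = (if u = v then 1 else 0)" if "u \<in> ?B" "v \<in> ?B" for u v
    using onb_inner[OF B(1) that] .
  have perp: "u \<bullet> \<theta> = 0" if "u \<in> BH \<union> BV" for u
    using orth[of u \<theta>] that B(4) by (metis UnCI insertCI)
  have sq: "u \<bullet> u = 1" if "u \<in> BH \<union> BV" for u
    using orth[of u u] that by simp
  have "lin_det (shear \<theta> a m b c) = (\<Prod>u\<in>?B. u \<bullet> shear \<theta> a m b c u)"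
  proof (rule lin_det_onb[OF B(1) linear_shear, of \<theta>])
    fix u v assume uv: "u \<in> ?B" "v \<in> ?B" "u \<noteq> \<theta>" "u \<noteq> v"
    then have "u \<bullet> \<theta> = 0" "u \<bullet> v = 0" using orth by auto
    moreover have "Hproj \<theta> v \<in> {0, v}" "Vproj \<theta> v \<in> {0, v}"
      using uv(2) VH HV B(8,9) Hproj_theta(1)[OF unit] Vproj_theta(1)[OF unit] by blast+
    ultimately show "u \<bullet> shear \<theta> a m b c v = 0"
      by (auto simp: shear_def inner_add_right)
  qed simp
  also have "\<dots> = (\<theta> \<bullet> shear \<theta> a m b c \<theta>) * (\<Prod>u\<in>BH. u \<bullet> shear \<theta> a m b c u)
      * (\<Prod>u\<in>BV. u \<bullet> shear \<theta> a m b c u)"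
    using B(2-5) by (simp add: prod.union_disjoint mult.assoc)
  also have "\<theta> \<bullet> shear \<theta> a m b c \<theta> = a"
    by (simp add: shear_def Hproj_theta Vproj_theta unit theta_sq assms)
  also have "(\<Prod>u\<in>BH. u \<bullet> shear \<theta> a m b c u) = (\<Prod>u\<in>BH. b)"
    by (rule prod.cong) (simp_all add: shear_def VH B(8) inner_add_right perp sq)
  also have "(\<Prod>u\<in>BV. u \<bullet> shear \<theta> a m b c u) = (\<Prod>u\<in>BV. c)"
    by (rule prod.cong) (simp_all add: shear_def HV B(9) inner_add_right perp sq)
  finally show ?thesis using B(6,7) by simp
qed

lemma cayley_metric_polar:
  assumes r: "r > 0"
  shows "cayley_metric (r *\<^sub>R \<theta>) u v = (u \<bullet> \<theta>) * (v \<bullet> \<theta>)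
    + (sinh r / r)\<^sup>2 * (Hproj \<theta> u \<bullet> Hproj \<theta> v) + (sinh r * cosh r / r)\<^sup>2 * (Vproj \<theta> u \<bullet> Vproj \<theta> v)"
proof -
  have "\<theta> \<noteq> 0" using unit by auto
  moreover have "sgn (r *\<^sub>R \<theta>) = \<theta>" using r unit by (simp add: sgn_scaleR sgn_div_norm)
  ultimately show ?thesis
    using r unit by (simp add: cayley_metric_def oproj_Hsp oproj_Vsp Let_def)
qed

text \<open>The Gram matrix is the matrix of a diagonal \<open>shear\<close>.\<close>

lemma gram_det_polar:
  assumes r: "r > 0"
  shows "gram_det (r *\<^sub>R \<theta>) = ((sinh r / r) ^ 8 * (sinh r * cosh r / r) ^ 7)\<^sup>2"
proof -
  have "cayley_metric (r *\<^sub>R \<theta>) u v = u \<bullet> shear \<theta> 1 0 ((sinh r / r)\<^sup>2) ((sinh r * cosh r / r)\<^sup>2) v" for u v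
    unfolding cayley_metric_polar[OF r]
    by (simp add: shear_def inner_add_right Hproj_selfadjoint Vproj_selfadjoint HV_compose unit mult.commute)
  then have "gram_det (r *\<^sub>R \<theta>) = lin_det (shear \<theta> 1 0 ((sinh r / r)\<^sup>2) ((sinh r * cosh r / r)\<^sup>2))"
    by (simp add: gram_det_def lin_det_def)
  also have "\<dots> = 1 * ((sinh r / r)\<^sup>2) ^ 8 * ((sinh r * cosh r / r)\<^sup>2) ^ 7"
    by (rule lin_det_shear) simp
  finally show ?thesis
    by (simp add: power_mult_distrib power_divide flip: power_mult)
qed

lemma metric_det_shear:
  assumes "r > 0" "s > 0" "m \<bullet> \<theta> = 0"
  shows "metric_det (r *\<^sub>R \<theta>) (s *\<^sub>R \<theta>) (shear \<theta> a m (s / r) (s / r))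
    = a * (sinh s ^ 15 * cosh s ^ 7) / (sinh r ^ 15 * cosh r ^ 7)"
proof -
  have "sinh r > 0" "sinh s > 0" using assms by simp_all
  then have "metric_det (r *\<^sub>R \<theta>) (s *\<^sub>R \<theta>) (shear \<theta> a m (s / r) (s / r))
    = a * (s / r) ^ 8 * (s / r) ^ 7 * ((sinh s / s) ^ 8 * (sinh s * cosh s / s) ^ 7)
       / ((sinh r / r) ^ 8 * (sinh r * cosh r / r) ^ 7)"
    using assms
    by (simp add: metric_det_def lin_det_shear gram_det_polar abs_mult power_abs)
  also have "\<dots> = a * (sinh s ^ 15 * cosh s ^ 7) / (sinh r ^ 15 * cosh r ^ 7)"
    using assms \<open>sinh r > 0\<close> by (simp add: field_simps flip: power_add)
  finally show ?thesis .
qed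

lemma polar_coords:
  assumes "Hproj \<theta> h = h" "Vproj \<theta> v = v"
  shows "(t *\<^sub>R \<theta> + h + v) \<bullet> \<theta> = t" "Hproj \<theta> (t *\<^sub>R \<theta> + h + v) = h" "Vproj \<theta> (t *\<^sub>R \<theta> + h + v) = v"
proof -
  have "Vproj \<theta> h = 0" "Hproj \<theta> v = 0" "h \<bullet> \<theta> = 0" "v \<bullet> \<theta> = 0"
    using HV_compose(2,3)[OF unit] Hproj_theta(2)[OF unit] Vproj_theta(2)[OF unit] assms by metis+
  then show "(t *\<^sub>R \<theta> + h + v) \<bullet> \<theta> = t" "Hproj \<theta> (t *\<^sub>R \<theta> + h + v) = h" "Vproj \<theta> (t *\<^sub>R \<theta> + h + v) = v"
    using assms by (simp_all add: inner_add_left theta_sq unit linear_add[OF linear_Hproj]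
       linear_add[OF linear_Vproj] linear_cmul[OF linear_Hproj] linear_cmul[OF linear_Vproj]
       Hproj_theta Vproj_theta)
qed

lemma polar_metric_nondegenerate:
  assumes r: "r > 0" and eq: "\<And>u. cayley_metric (r *\<^sub>R \<theta>) w u = cayley_metric (r *\<^sub>R \<theta>) w' u"
  shows "w = w'"
proof -
  let ?d = "w - w'"
  have "sinh r > 0" using r by simp
  have "cayley_metric (r *\<^sub>R \<theta>) ?d u = 0" for u
    using eq[of u] unfolding cayley_metric_polar[OF r]
    by (simp add: linear_diff[OF linear_Hproj] linear_diff[OF linear_Vproj] inner_diff_left algebra_simps)
  then have "(?d \<bullet> \<theta>)\<^sup>2 + (sinh r / r)\<^sup>2 * (norm (Hproj \<theta> ?d))\<^sup>2
      + (sinh r * cosh r / r)\<^sup>2 * (norm (Vproj \<theta> ?d))\<^sup>2 = 0"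
    unfolding cayley_metric_polar[OF r] by (metis power2_eq_square power2_norm_eq_inner)
  then have "(?d \<bullet> \<theta>)\<^sup>2 = 0 \<and> (sinh r / r)\<^sup>2 * (norm (Hproj \<theta> ?d))\<^sup>2 = 0
      \<and> (sinh r * cosh r / r)\<^sup>2 * (norm (Vproj \<theta> ?d))\<^sup>2 = 0"
    by (smt (verit) zero_le_power2 mult_nonneg_nonneg)
  then have "?d \<bullet> \<theta> = 0" "Hproj \<theta> ?d = 0" "Vproj \<theta> ?d = 0"
    using r \<open>sinh r > 0\<close> by auto
  then have "?d = 0" using decompose[OF unit, of ?d] by simp
  then show ?thesis by simp
qed

text \<open>The inverse transpose is found by solving the block triangular system; the proof exhibits the
  transpose \<open>A\<close> and its inverse \<open>B\<close> and checks the defining properties.\<close>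

lemma cof_shear:
  assumes r: "r > 0" and s: "s > 0" and m: "m \<bullet> \<theta> = 0" and a: "a \<noteq> 0"
  defines "p \<equiv> (sinh r / r)\<^sup>2" and "q \<equiv> (sinh r * cosh r / r)\<^sup>2"
    and "P \<equiv> (sinh s / s)\<^sup>2" and "Q \<equiv> (sinh s * cosh s / s)\<^sup>2"
  shows "cof (r *\<^sub>R \<theta>) (s *\<^sub>R \<theta>) (shear \<theta> a m (s / r) (s / r)) \<nu> =
    (a * (sinh s ^ 15 * cosh s ^ 7) / (sinh r ^ 15 * cosh r ^ 7)) *\<^sub>R
      (((\<nu> \<bullet> \<theta>) / a) *\<^sub>R \<theta>
       + (r / (s * P)) *\<^sub>R (p *\<^sub>R Hproj \<theta> \<nu> - ((\<nu> \<bullet> \<theta>) / a) *\<^sub>R Hproj \<theta> m)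
       + (r / (s * Q)) *\<^sub>R (q *\<^sub>R Vproj \<theta> \<nu> - ((\<nu> \<bullet> \<theta>) / a) *\<^sub>R Vproj \<theta> m))"
proof -
  let ?L = "shear \<theta> a m (s / r) (s / r)"
  have pos: "p > 0" "q > 0" "P > 0" "Q > 0"
    using r s by (simp_all add: p_def q_def P_def Q_def)
  define A where "A w = (a * (w \<bullet> \<theta>)) *\<^sub>R \<theta>
      + (1 / p) *\<^sub>R ((P * (s / r)) *\<^sub>R Hproj \<theta> w + (w \<bullet> \<theta>) *\<^sub>R Hproj \<theta> m)
      + (1 / q) *\<^sub>R ((Q * (s / r)) *\<^sub>R Vproj \<theta> w + (w \<bullet> \<theta>) *\<^sub>R Vproj \<theta> m)" for w
  define B where "B u = ((u \<bullet> \<theta>) / a) *\<^sub>R \<theta>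
       + (r / (s * P)) *\<^sub>R (p *\<^sub>R Hproj \<theta> u - ((u \<bullet> \<theta>) / a) *\<^sub>R Hproj \<theta> m)
       + (r / (s * Q)) *\<^sub>R (q *\<^sub>R Vproj \<theta> u - ((u \<bullet> \<theta>) / a) *\<^sub>R Vproj \<theta> m)" for u
  note lin = linear_add[OF linear_Hproj] linear_add[OF linear_Vproj]
    linear_diff[OF linear_Hproj] linear_diff[OF linear_Vproj]
    linear_cmul[OF linear_Hproj] linear_cmul[OF linear_Vproj]
  have A: "A w \<bullet> \<theta> = a * (w \<bullet> \<theta>)"
    "Hproj \<theta> (A w) = (1 / p) *\<^sub>R ((P * (s / r)) *\<^sub>R Hproj \<theta> w + (w \<bullet> \<theta>) *\<^sub>R Hproj \<theta> m)"
    "Vproj \<theta> (A w) = (1 / q) *\<^sub>R ((Q * (s / r)) *\<^sub>R Vproj \<theta> w + (w \<bullet> \<theta>) *\<^sub>R Vproj \<theta> m)" for w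
    unfolding A_def by (rule polar_coords; simp add: lin HV_compose unit)+
  have B: "B u \<bullet> \<theta> = (u \<bullet> \<theta>) / a"
    "Hproj \<theta> (B u) = (r / (s * P)) *\<^sub>R (p *\<^sub>R Hproj \<theta> u - ((u \<bullet> \<theta>) / a) *\<^sub>R Hproj \<theta> m)"
    "Vproj \<theta> (B u) = (r / (s * Q)) *\<^sub>R (q *\<^sub>R Vproj \<theta> u - ((u \<bullet> \<theta>) / a) *\<^sub>R Vproj \<theta> m)" for u
    unfolding B_def by (rule polar_coords; simp add: lin HV_compose unit)+
  have L: "?L u \<bullet> \<theta> = a * (u \<bullet> \<theta>) + m \<bullet> u"
    "Hproj \<theta> (?L u) = (s / r) *\<^sub>R Hproj \<theta> u" "Vproj \<theta> (?L u) = (s / r) *\<^sub>R Vproj \<theta> u" for u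
    unfolding shear_def by (rule polar_coords; simp add: lin HV_compose unit)+
  have m_inner: "m \<bullet> u = Hproj \<theta> m \<bullet> Hproj \<theta> u + Vproj \<theta> m \<bullet> Vproj \<theta> u" for u
  proof -
    have "m \<bullet> u = m \<bullet> ((u \<bullet> \<theta>) *\<^sub>R \<theta> + Hproj \<theta> u + Vproj \<theta> u)"
      using decompose[OF unit, of u] by simp
    then show ?thesis
      using m by (simp add: inner_add_right Hproj_selfadjoint Vproj_selfadjoint HV_compose unit)
  qed
  have adj: "cayley_metric (r *\<^sub>R \<theta>) (A w) u = cayley_metric (s *\<^sub>R \<theta>) w (?L u)" for w u
    unfolding cayley_metric_polar[OF r] cayley_metric_polar[OF s] A L
      p_def[symmetric] q_def[symmetric] P_def[symmetric] Q_def[symmetric] m_inner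
    using pos r s by (simp add: inner_add_left distrib_left mult.left_commute)
  have "metric_transpose (r *\<^sub>R \<theta>) (s *\<^sub>R \<theta>) ?L = A"
    unfolding metric_transpose_def
  proof (rule the_equality)
    show "\<forall>w u. cayley_metric (r *\<^sub>R \<theta>) (A w) u = cayley_metric (s *\<^sub>R \<theta>) w (?L u)"
      using adj by blast
    fix A' assume "\<forall>w u. cayley_metric (r *\<^sub>R \<theta>) (A' w) u = cayley_metric (s *\<^sub>R \<theta>) w (?L u)"
    then show "A' = A"
      using polar_metric_nondegenerate[OF r] adj by (metis ext)
  qed
  moreover have "inv A = B"
  proof (rule inv_equality)
    fix u
    show "B (A u) = u"
      unfolding B_def[of "A u"] A using pos r s a
      by (subst (5) decompose[OF unit, of u]) (simp add: scaleR_add_right)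
    show "A (B u) = u"
      unfolding A_def[of "B u"] B using pos r s a
      by (subst (5) decompose[OF unit, of u]) (simp add: scaleR_add_right scaleR_diff_right)
  qed
  ultimately show ?thesis
    unfolding cof_def metric_det_shear[OF r s m] by (simp add: B_def)
qed

end

section \<open>The volume radius\<close>

lemma cosh_even_powers:
  fixes s :: real
  shows "(cosh s)\<^sup>2 = 1 + (sinh s)\<^sup>2" "cosh s ^ 7 = cosh s * (1 + (sinh s)\<^sup>2) ^ 3"
proof -
  show 1: "(cosh s)\<^sup>2 = 1 + (sinh s)\<^sup>2" by (simp add: cosh_square_eq)
  show "cosh s ^ 7 = cosh s * (1 + (sinh s)\<^sup>2) ^ 3"
    unfolding 1[symmetric] by (simp flip: power_mult power_Suc)
qed

text \<open>The quotient \<open>R / R'(r)\<close>, which is the speed of the radius under \<open>R \<mapsto> exp \<tau> R\<close>, in closed form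
  (see \<open>DERIV_volume_radius\<close> and \<open>DERIV_dilated_radius\<close>).\<close>

definition radial_speed :: "real \<Rightarrow> real" where
  "radial_speed r = sinh r * Lpol ((sinh r)\<^sup>2) / (165 * cosh r ^ 7)"

text \<open>The closed form of the 16th power of the volume radius.\<close>

definition volume_power :: "real \<Rightarrow> real" where
  "volume_power r = sinh r ^ 16 * Lpol ((sinh r)\<^sup>2) / 165"

lemma Lpol_ge: "x \<ge> 0 \<Longrightarrow> Lpol x \<ge> 165"
  by (simp add: Lpol_def)

lemma Lpol_pos: "x \<ge> 0 \<Longrightarrow> Lpol x > 0"
  using Lpol_ge[of x] by linarith

text \<open>The substitution \<open>x = sinh\<^sup>2 r\<close> turns the volume integral into that of \<open>8 x\<^sup>7 (1 + x)\<^sup>3\<close>, whose primitive is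
  \<open>x\<^sup>8 L(x) / 165\<close>.\<close>

lemma DERIV_volume_power:
  "(volume_power has_real_derivative 16 * (sinh r ^ 15 * cosh r ^ 7)) (at r within S)"
proof -
  show ?thesis
    unfolding volume_power_def Lpol_def cosh_even_powers(2)
    by (rule derivative_eq_intros refl | simp)+ (simp add: field_simps eval_nat_numeral)
qed

lemma volume_radius_eq:
  assumes "r \<ge> 0" shows "volume_radius r = root 16 (volume_power r)"
proof -
  have "((\<lambda>s. 16 * (sinh s ^ 15 * cosh s ^ 7)) has_integral (volume_power r - volume_power 0)) {0..r}"
    using assms DERIV_volume_power
    by (intro fundamental_theorem_of_calculus) (simp_all add: has_real_derivative_iff_has_vector_derivative)
  then have "integral {0..r} (\<lambda>s. 16 * (sinh s ^ 15 * cosh s ^ 7)) = volume_power r - volume_power 0"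
    by (rule integral_unique)
  also have "volume_power 0 = 0" by (simp add: volume_power_def)
  finally show ?thesis
    by (simp add: volume_radius_def)
qed

lemma volume_power_pos: "r > 0 \<Longrightarrow> volume_power r > 0"
  by (simp add: volume_power_def Lpol_pos)

lemma volume_radius_pos: "r > 0 \<Longrightarrow> volume_radius r > 0"
  by (simp add: volume_radius_eq volume_power_pos)

lemma volume_radius_pow: "r \<ge> 0 \<Longrightarrow> volume_radius r ^ 16 = volume_power r"
  by (simp add: volume_radius_eq volume_power_def Lpol_pos less_imp_le)

lemma volume_power_speed:
  "volume_power r = radial_speed r * (sinh r ^ 15 * cosh r ^ 7)"
proof -
  have "sinh r ^ 16 = sinh r * sinh r ^ 15" by (simp flip: power_Suc)
  then show ?thesis by (simp add: volume_power_def radial_speed_def)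
qed

lemma radial_speed_pos: "r > 0 \<Longrightarrow> radial_speed r > 0"
  by (simp add: radial_speed_def Lpol_pos)

lemma DERIV_volume_radius:
  assumes r: "r > 0"
  shows "(volume_radius has_real_derivative volume_radius r / radial_speed r) (at r)"
proof -
  have V: "volume_radius r > 0" using r by (rule volume_radius_pos)
  have "((\<lambda>r. root 16 (volume_power r)) has_real_derivative
      inverse (real 16 * root 16 (volume_power r) ^ (16 - Suc 0)) * (16 * (sinh r ^ 15 * cosh r ^ 7))) (at r)"
    using volume_power_pos[OF r]
    by (intro DERIV_chain2[OF DERIV_real_root] DERIV_volume_power) auto
  also have "inverse (real 16 * root 16 (volume_power r) ^ (16 - Suc 0)) * (16 * (sinh r ^ 15 * cosh r ^ 7))
      = volume_radius r / radial_speed r"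
  proof -
    have "volume_radius r * volume_radius r ^ 15 = radial_speed r * (sinh r ^ 15 * cosh r ^ 7)"
      using volume_radius_pow[of r] r volume_power_speed[of r] by (simp flip: power_Suc)
    then show ?thesis
      using V radial_speed_pos[OF r] r by (simp add: volume_radius_eq[symmetric] field_simps)
  qed
  finally show ?thesis
    by (rule has_field_derivative_transform_within_open[of _ _ _ "{0<..}"])
       (use r in \<open>auto simp: volume_radius_eq\<close>)
qed

lemma volume_radius_0: "volume_radius 0 = 0"
  by (simp add: volume_radius_eq volume_power_def)

lemma continuous_volume_radius: "continuous_on {0..} volume_radius"
proof -
  have "continuous_on {0..} (\<lambda>r. root 16 (volume_power r))"
    unfolding volume_power_def Lpol_def by (intro continuous_intros) auto
  then show ?thesis
    by (rule continuous_on_eq) (simp add: volume_radius_eq)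
qed

lemma volume_radius_strict_mono:
  assumes "0 \<le> a" "a < b" shows "volume_radius a < volume_radius b"
proof (rule DERIV_pos_imp_increasing_open[OF assms(2)])
  show "\<exists>y. (volume_radius has_real_derivative y) (at x) \<and> 0 < y" if "a < x" "x < b" for x
    using DERIV_volume_radius[of x] volume_radius_pos[of x] radial_speed_pos[of x] that assms
    by (intro exI[of _ "volume_radius x / radial_speed x"]) auto
  show "continuous_on {a..b} volume_radius"
    using continuous_on_subset[OF continuous_volume_radius] assms by auto
qed

lemma volume_radius_ge: assumes "r \<ge> 0" shows "r \<le> volume_radius r"
proof -
  \<comment> \<open>A crude lower bound suffices: it makes the volume radius unbounded, hence onto.\<close>
  have "r \<le> sinh r" using assms
  proof -
    have "sinh 0 - 0 \<le> sinh r - r"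
    proof (rule DERIV_nonneg_imp_nondecreasing[OF assms])
      fix x :: real
      have "((\<lambda>x. sinh x - x) has_real_derivative cosh x - 1) (at x)"
        by (auto intro!: derivative_eq_intros)
      moreover have "0 \<le> cosh x - 1" using cosh_real_ge_1[of x] by simp
      ultimately show "\<exists>y. ((\<lambda>x. sinh x - x) has_real_derivative y) (at x) \<and> 0 \<le> y" by blast
    qed
    then show ?thesis by simp
  qed
  also have "sinh r = root 16 (sinh r ^ 16)" using assms by (simp add: real_root_power_cancel)
  also have "\<dots> \<le> root 16 (volume_power r)"
    using Lpol_ge[of "(sinh r)\<^sup>2"] mult_left_mono[of 165 "Lpol ((sinh r)\<^sup>2)" "sinh r ^ 16"]
    by (simp add: volume_power_def)
  finally show ?thesis using assms by (simp add: volume_radius_eq)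
qed

definition radius_of :: "real \<Rightarrow> real" where
  "radius_of = inv_into {0..} volume_radius"

lemma radius_of_volume_radius: "r \<ge> 0 \<Longrightarrow> radius_of (volume_radius r) = r"
proof -
  have "inj_on volume_radius {0..}"
    by (rule linorder_inj_onI) (use volume_radius_strict_mono in force)+
  then show "r \<ge> 0 \<Longrightarrow> radius_of (volume_radius r) = r"
    unfolding radius_of_def by (simp add: inv_into_f_f)
qed

lemma radius_of:
  assumes "y > 0" shows "radius_of y > 0" "volume_radius (radius_of y) = y"
proof -
  have "\<exists>r\<ge>0. r \<le> y \<and> volume_radius r = y"
    using volume_radius_ge[of y] assms volume_radius_0
    by (intro IVT') (auto intro: continuous_on_subset[OF continuous_volume_radius])
  then obtain r where r: "r \<ge> 0" "volume_radius r = y" by blast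
  then have "radius_of y = r" using radius_of_volume_radius by blast
  moreover have "r \<noteq> 0" using r assms volume_radius_0 by auto
  ultimately show "radius_of y > 0" "volume_radius (radius_of y) = y" using r by auto
qed

text \<open>The inverse function theorem; the volume radius has a positive derivative away from the base point.\<close>

lemma DERIV_radius_of:
  assumes y: "y > 0"
  shows "(radius_of has_real_derivative radial_speed (radius_of y) / y) (at y)"
proof -
  let ?r = "radius_of y"
  have r: "?r > 0" "volume_radius ?r = y" using radius_of[OF y] by auto
  have "isCont radius_of (volume_radius ?r)"
  proof (rule isCont_inverse_function2[of "?r / 2" ?r "?r + 1"])
    fix z assume "?r / 2 \<le> z"
    then have "z > 0" using r by simp
    then show "radius_of (volume_radius z) = z" "isCont volume_radius z"
      using DERIV_isCont[OF DERIV_volume_radius] by (simp_all add: radius_of_volume_radius)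
  qed (use r in simp_all)
  then have cont: "isCont radius_of y" by (simp only: r(2))
  have "(volume_radius has_real_derivative y / radial_speed ?r) (at ?r)"
    using DERIV_volume_radius[OF r(1)] r(2) by simp
  moreover have "y / radial_speed ?r \<noteq> 0" using radial_speed_pos[OF r(1)] y by simp
  ultimately have "(radius_of has_real_derivative inverse (y / radial_speed ?r)) (at y)"
    by (rule DERIV_inverse_function[where a = 0 and b = "y + 1"])
       (simp_all add: y radius_of(2) cont)
  then show ?thesis by simp
qed

text \<open>The radius of the image of a point at radius \<open>r\<close> when its volume radius is multiplied by \<open>exp \<tau>\<close>.\<close>

definition dilated_radius :: "real \<Rightarrow> real \<Rightarrow> real" where
  "dilated_radius r \<tau> = radius_of (exp \<tau> * volume_radius r)"

context
  fixes r :: real assumes r: "r > 0"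
begin

lemma dilated_radius_pos: "dilated_radius r \<tau> > 0"
  unfolding dilated_radius_def using radius_of(1) volume_radius_pos[OF r] by simp

lemma dilated_radius_0: "dilated_radius r 0 = r"
  unfolding dilated_radius_def using radius_of_volume_radius r by simp

lemma DERIV_dilated_radius:
  "(dilated_radius r has_real_derivative radial_speed (dilated_radius r \<tau>)) (at \<tau>)"
proof -
  have pos: "exp \<tau> * volume_radius r > 0" using volume_radius_pos[OF r] by simp
  have "((\<lambda>\<tau>. radius_of (exp \<tau> * volume_radius r)) has_real_derivative
     radial_speed (radius_of (exp \<tau> * volume_radius r)) / (exp \<tau> * volume_radius r)
       * (exp \<tau> * volume_radius r)) (at \<tau>)"
    by (rule DERIV_chain2[where f = radius_of and g = "\<lambda>\<tau>. exp \<tau> * volume_radius r"])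
       (auto intro!: derivative_eq_intros DERIV_radius_of[OF pos])
  then show ?thesis using pos volume_radius_pos[OF r] by (simp add: dilated_radius_def[abs_def])
qed

lemma volume_power_dilated: "volume_power (dilated_radius r \<tau>) = exp (16 * \<tau>) * volume_power r"
proof -
  have "exp \<tau> * volume_radius r > 0" using volume_radius_pos[OF r] by simp
  then have "volume_radius (dilated_radius r \<tau>) = exp \<tau> * volume_radius r"
    unfolding dilated_radius_def by (rule radius_of(2))
  then show ?thesis
    using volume_radius_pow[of r] volume_radius_pow[of "dilated_radius r \<tau>"] r dilated_radius_pos[of \<tau>]
    by (simp add: power_mult_distrib exp_of_nat_mult[of 16, simplified])
qed

end

section \<open>The deformation and its Jacobian\<close>

lemma has_derivative_sgn_polar:
  fixes \<theta> :: "'a::real_inner"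
  assumes unit: "norm \<theta> = 1" and r: "r > 0"
  shows "(sgn has_derivative (\<lambda>u. (u - (u \<bullet> \<theta>) *\<^sub>R \<theta>) /\<^sub>R r)) (at (r *\<^sub>R \<theta>))"
proof -
  have nz: "r *\<^sub>R \<theta> \<noteq> 0" and sgn: "sgn (r *\<^sub>R \<theta>) = \<theta>" and norm: "norm (r *\<^sub>R \<theta>) = r"
    using unit r by (auto simp: sgn_div_norm)
  have N: "(norm has_derivative (\<lambda>u. u \<bullet> \<theta>)) (at (r *\<^sub>R \<theta>))"
    using has_derivative_norm[OF nz] by (simp add: sgn)
  have "((\<lambda>x. inverse (norm x) *\<^sub>R x) has_derivative
     (\<lambda>u. inverse (norm (r *\<^sub>R \<theta>)) *\<^sub>R u
        + (- (inverse (norm (r *\<^sub>R \<theta>)) * (u \<bullet> \<theta>) * inverse (norm (r *\<^sub>R \<theta>)))) *\<^sub>R (r *\<^sub>R \<theta>))) (at (r *\<^sub>R \<theta>))"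
    using nz by (intro derivative_intros N) simp
  then have "(sgn has_derivative
     (\<lambda>u. inverse r *\<^sub>R u + (- (inverse r * (u \<bullet> \<theta>) * inverse r)) *\<^sub>R (r *\<^sub>R \<theta>))) (at (r *\<^sub>R \<theta>))"
    unfolding norm sgn_div_norm[abs_def] .
  then show ?thesis
    by (rule has_derivative_eq_rhs) (use r in \<open>simp add: fun_eq_iff scaleR_diff_right\<close>)
qed

context
  fixes \<theta> :: cayley and r :: real
  assumes unit: "norm \<theta> = 1" and r: "r > 0"
begin

text \<open>Along the ray the deformation is the dilation of the volume radius; across it, the angular part is
  scaled by \<open>s / r\<close>, and the gradient of the affine function enters the radial component. Affine functions
  cover both the coordinate functions and the constant 1.\<close>

lemma has_derivative_deform:
  fixes a :: cayley and b t :: real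
  defines "s \<equiv> dilated_radius r (t * (\<theta> \<bullet> a + b))"
  shows "(deform t (\<lambda>\<omega>. \<omega> \<bullet> a + b) has_derivative
    shear \<theta> (radial_speed s / radial_speed r)
      ((t * radial_speed s / r) *\<^sub>R (a - (a \<bullet> \<theta>) *\<^sub>R \<theta>)) (s / r) (s / r)) (at (r *\<^sub>R \<theta>))"
proof -
  let ?z = "r *\<^sub>R \<theta>"
  have nz: "?z \<noteq> 0" and sgn: "sgn ?z = \<theta>" and norm: "norm ?z = r"
    using unit r by (auto simp: sgn_div_norm)
  have N: "(norm has_derivative (\<lambda>u. u \<bullet> \<theta>)) (at ?z)"
    using has_derivative_norm[OF nz] by (simp add: sgn)
  note S = has_derivative_sgn_polar[OF unit r]
  have V: "volume_radius r > 0" by (rule volume_radius_pos[OF r])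
  have "((\<lambda>x. volume_radius (norm x)) has_derivative (\<lambda>u. volume_radius r / radial_speed r * (u \<bullet> \<theta>))) (at ?z)"
    using DERIV_volume_radius[OF r]
    unfolding has_field_derivative_def by (intro has_derivative_compose[OF N]) (simp only: norm)
  moreover have "((\<lambda>x. t * (sgn x \<bullet> a + b)) has_derivative
     (\<lambda>u. t * (((u - (u \<bullet> \<theta>) *\<^sub>R \<theta>) /\<^sub>R r) \<bullet> a))) (at ?z)"
    by (auto intro!: derivative_eq_intros S)
  from has_derivative_exp[OF this] have "((\<lambda>x. exp (t * (sgn x \<bullet> a + b))) has_derivative
     (\<lambda>u. (t * (((u - (u \<bullet> \<theta>) *\<^sub>R \<theta>) /\<^sub>R r) \<bullet> a)) * exp (t * (\<theta> \<bullet> a + b)))) (at ?z)"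
    by (simp only: sgn)
  ultimately have "((\<lambda>x. exp (t * (sgn x \<bullet> a + b)) * volume_radius (norm x)) has_derivative
     (\<lambda>u. exp (t * (\<theta> \<bullet> a + b)) * (volume_radius r / radial_speed r * (u \<bullet> \<theta>))
        + (t * (((u - (u \<bullet> \<theta>) *\<^sub>R \<theta>) /\<^sub>R r) \<bullet> a)) * exp (t * (\<theta> \<bullet> a + b)) * volume_radius r)) (at ?z)"
    using has_derivative_mult[of "\<lambda>x. exp (t * (sgn x \<bullet> a + b))" _ ?z UNIV "\<lambda>x. volume_radius (norm x)"]
    by (simp only: sgn norm)
  moreover have "exp (t * (\<theta> \<bullet> a + b)) * volume_radius r > 0" using V by simp
  from DERIV_radius_of[OF this]
  have "(radius_of has_derivative (*) (radial_speed s / (exp (t * (\<theta> \<bullet> a + b)) * volume_radius r)))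
      (at (exp (t * (sgn ?z \<bullet> a + b)) * volume_radius (norm ?z)))"
    unfolding s_def dilated_radius_def has_field_derivative_def sgn norm .
  ultimately have "((\<lambda>x. radius_of (exp (t * (sgn x \<bullet> a + b)) * volume_radius (norm x))) has_derivative
     (\<lambda>u. radial_speed s / (exp (t * (\<theta> \<bullet> a + b)) * volume_radius r) *
       (exp (t * (\<theta> \<bullet> a + b)) * (volume_radius r / radial_speed r * (u \<bullet> \<theta>))
        + (t * (((u - (u \<bullet> \<theta>) *\<^sub>R \<theta>) /\<^sub>R r) \<bullet> a)) * exp (t * (\<theta> \<bullet> a + b)) * volume_radius r))) (at ?z)"
    by (rule has_derivative_compose)
  also have "(\<lambda>u. radial_speed s / (exp (t * (\<theta> \<bullet> a + b)) * volume_radius r) *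
       (exp (t * (\<theta> \<bullet> a + b)) * (volume_radius r / radial_speed r * (u \<bullet> \<theta>))
        + (t * (((u - (u \<bullet> \<theta>) *\<^sub>R \<theta>) /\<^sub>R r) \<bullet> a)) * exp (t * (\<theta> \<bullet> a + b)) * volume_radius r))
    = (\<lambda>u. radial_speed s / radial_speed r * (u \<bullet> \<theta>)
        + ((t * radial_speed s / r) *\<^sub>R (a - (a \<bullet> \<theta>) *\<^sub>R \<theta>)) \<bullet> u)"
    using V radial_speed_pos[OF r] r
    by (simp add: fun_eq_iff inner_diff_left inner_diff_right field_simps inner_commute)
  finally have f: "((\<lambda>x. radius_of (exp (t * (sgn x \<bullet> a + b)) * volume_radius (norm x))) has_derivative
     (\<lambda>u. radial_speed s / radial_speed r * (u \<bullet> \<theta>)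
        + ((t * radial_speed s / r) *\<^sub>R (a - (a \<bullet> \<theta>) *\<^sub>R \<theta>)) \<bullet> u)) (at ?z)" .
  have s': "radius_of (exp (t * (sgn ?z \<bullet> a + b)) * volume_radius (norm ?z)) = s"
    by (simp only: sgn norm s_def dilated_radius_def)
  have "((\<lambda>x. radius_of (exp (t * (sgn x \<bullet> a + b)) * volume_radius (norm x)) *\<^sub>R sgn x) has_derivative
     (\<lambda>u. s *\<^sub>R ((u - (u \<bullet> \<theta>) *\<^sub>R \<theta>) /\<^sub>R r) + (radial_speed s / radial_speed r * (u \<bullet> \<theta>)
        + ((t * radial_speed s / r) *\<^sub>R (a - (a \<bullet> \<theta>) *\<^sub>R \<theta>)) \<bullet> u) *\<^sub>R \<theta>)) (at ?z)"
    using has_derivative_scaleR[OF f S] unfolding s' unfolding sgn .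
  moreover have split: "s *\<^sub>R ((u - (u \<bullet> \<theta>) *\<^sub>R \<theta>) /\<^sub>R r) = (s / r) *\<^sub>R Hproj \<theta> u + (s / r) *\<^sub>R Vproj \<theta> u" for u
  proof -
    have "u - (u \<bullet> \<theta>) *\<^sub>R \<theta> = Hproj \<theta> u + Vproj \<theta> u" by (simp add: Hproj_def Vproj_def)
    then show ?thesis by (simp add: scaleR_add_right divide_inverse)
  qed
  ultimately show ?thesis
    unfolding deform_def[abs_def] radius_of_def[symmetric] shear_def[abs_def]
    by (elim has_derivative_eq_rhs) (simp only: split ac_simps)
qed

text \<open>The determinant is \<open>A D(s) / D(r)\<close> with \<open>D = sinh\<^sup>1\<^sup>5 cosh\<^sup>7\<close> and \<open>A = k(s) / k(r)\<close>, where \<open>k = R / R'\<close>. As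
  \<open>k D = R\<^sup>1\<^sup>6\<close>, it equals \<open>exp (16 \<tau>)\<close>.\<close>

lemma jac_polar:
  fixes a \<nu> :: cayley and b t :: real
  defines "s \<equiv> dilated_radius r (t * (\<theta> \<bullet> a + b))"
    and "k \<equiv> radial_speed r" and "\<alpha> \<equiv> \<nu> \<bullet> \<theta>"
  shows "jac (r *\<^sub>R \<theta>) \<nu> (\<lambda>\<omega>. \<omega> \<bullet> a + b) t = sqrt (exp (32 * (t * (\<theta> \<bullet> a + b))) *
    ((\<alpha> * k / radial_speed s)\<^sup>2
     + (r / sinh s)\<^sup>2 * (norm ((sinh r / r)\<^sup>2 *\<^sub>R Hproj \<theta> \<nu> - (\<alpha> * t * k / r) *\<^sub>R Hproj \<theta> a))\<^sup>2
     + (r / (sinh s * cosh s))\<^sup>2 *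
        (norm ((sinh r * cosh r / r)\<^sup>2 *\<^sub>R Vproj \<theta> \<nu> - (\<alpha> * t * k / r) *\<^sub>R Vproj \<theta> a))\<^sup>2))"
proof -
  let ?z = "r *\<^sub>R \<theta>" and ?\<tau> = "t * (\<theta> \<bullet> a + b)"
  have sgn: "sgn ?z = \<theta>" and norm: "norm ?z = r"
    using unit r by (auto simp: sgn_div_norm)
  have s: "s > 0" unfolding s_def by (rule dilated_radius_pos[OF r])
  have ks: "radial_speed s > 0" and k: "k > 0"
    using s r by (simp_all add: radial_speed_pos k_def)
  define A where "A = radial_speed s / k"
  have A: "A > 0" using ks k by (simp add: A_def)
  define m where "m = (t * radial_speed s / r) *\<^sub>R (a - (a \<bullet> \<theta>) *\<^sub>R \<theta>)"
  have m: "m \<bullet> \<theta> = 0" by (simp add: m_def inner_diff_left theta_sq[OF unit])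
  have Hm: "Hproj \<theta> m = (t * radial_speed s / r) *\<^sub>R Hproj \<theta> a"
    by (simp add: m_def linear_cmul[OF linear_Hproj] linear_diff[OF linear_Hproj] Hproj_theta unit)
  have Vm: "Vproj \<theta> m = (t * radial_speed s / r) *\<^sub>R Vproj \<theta> a"
    by (simp add: m_def linear_cmul[OF linear_Vproj] linear_diff[OF linear_Vproj] Vproj_theta unit)
  have y: "deform t (\<lambda>\<omega>. \<omega> \<bullet> a + b) ?z = s *\<^sub>R \<theta>"
    by (simp only: deform_def sgn norm s_def dilated_radius_def radius_of_def)
  have D: "frechet_derivative (deform t (\<lambda>\<omega>. \<omega> \<bullet> a + b)) (at ?z) = shear \<theta> A m (s / r) (s / r)"
    using frechet_derivative_at[OF has_derivative_deform[of t a b]]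
    by (simp add: A_def k_def m_def s_def)
  let ?E = "exp (16 * ?\<tau>)"
  have E: "A * (sinh s ^ 15 * cosh s ^ 7) / (sinh r ^ 15 * cosh r ^ 7) = ?E"
  proof -
    have "radial_speed s * (sinh s ^ 15 * cosh s ^ 7) = ?E * (k * (sinh r ^ 15 * cosh r ^ 7))"
      using volume_power_dilated[OF r, of ?\<tau>] by (simp only: volume_power_speed k_def s_def)
    then show ?thesis using r k by (simp add: A_def divide_simps)
  qed
  define P Q p q where PQ: "P = (sinh s / s)\<^sup>2" "Q = (sinh s * cosh s / s)\<^sup>2"
    "p = (sinh r / r)\<^sup>2" "q = (sinh r * cosh r / r)\<^sup>2"
  define h where "h = p *\<^sub>R Hproj \<theta> \<nu> - (\<alpha> * t * k / r) *\<^sub>R Hproj \<theta> a"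
  define v where "v = q *\<^sub>R Vproj \<theta> \<nu> - (\<alpha> * t * k / r) *\<^sub>R Vproj \<theta> a"
  have am: "(\<alpha> / A) *\<^sub>R Hproj \<theta> m = (\<alpha> * t * k / r) *\<^sub>R Hproj \<theta> a"
    "(\<alpha> / A) *\<^sub>R Vproj \<theta> m = (\<alpha> * t * k / r) *\<^sub>R Vproj \<theta> a"
    using ks k by (simp_all add: Hm Vm A_def field_simps)
  define H V where HV_def: "H = r / (s * P)" "V = r / (s * Q)"
  let ?c = "(\<alpha> / A) *\<^sub>R \<theta> + H *\<^sub>R h + V *\<^sub>R v"
  have cof: "cof ?z (s *\<^sub>R \<theta>) (shear \<theta> A m (s / r) (s / r)) \<nu> = ?E *\<^sub>R ?c"
    unfolding cof_shear[OF unit r s m less_imp_neq[OF A, symmetric]] E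
    by (simp only: h_def v_def am[symmetric, unfolded \<alpha>_def] PQ HV_def \<alpha>_def)
  have hv: "Hproj \<theta> (H *\<^sub>R h) = H *\<^sub>R h"
    "Vproj \<theta> (V *\<^sub>R v) = V *\<^sub>R v"
    by (simp_all add: h_def v_def linear_cmul[OF linear_Hproj] linear_diff[OF linear_Hproj]
        linear_cmul[OF linear_Vproj] linear_diff[OF linear_Vproj] HV_compose unit)
  have "cayley_metric (s *\<^sub>R \<theta>) (?E *\<^sub>R ?c) (?E *\<^sub>R ?c) = ?E\<^sup>2 *
     ((\<alpha> / A)\<^sup>2 + P * (H\<^sup>2 * (norm h)\<^sup>2) + Q * (V\<^sup>2 * (norm v)\<^sup>2))"
    unfolding cayley_metric_polar[OF unit s] linear_cmul[OF linear_Hproj] linear_cmul[OF linear_Vproj]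
      inner_scaleR_left inner_scaleR_right polar_coords[OF unit hv] PQ(1,2)[symmetric]
    unfolding power2_norm_eq_inner by (simp add: power2_eq_square algebra_simps)
  also have "?E\<^sup>2 = exp (32 * ?\<tau>)" by (simp add: exp_double[symmetric] flip: exp_double)
  also have "P * (H\<^sup>2 * (norm h)\<^sup>2) = (r / sinh s)\<^sup>2 * (norm h)\<^sup>2"
    using s by (simp add: PQ HV_def field_simps power2_eq_square)
  also have "Q * (V\<^sup>2 * (norm v)\<^sup>2) = (r / (sinh s * cosh s))\<^sup>2 * (norm v)\<^sup>2"
    using s by (simp add: PQ HV_def field_simps power2_eq_square)
  also have "(\<alpha> / A)\<^sup>2 = (\<alpha> * k / radial_speed s)\<^sup>2" by (simp add: A_def)
  finally show ?thesis
    unfolding jac_def Let_def y D cof h_def v_def PQ by simp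
qed

end

section \<open>Second-order Taylor data\<close>

text \<open>The first derivative is required to exist everywhere, and not only at 0, so that iterating \<open>deriv\<close>
  gives the second one.\<close>

definition has_jet2 :: "(real \<Rightarrow> real) \<Rightarrow> real \<Rightarrow> real \<Rightarrow> real \<Rightarrow> bool" where
  "has_jet2 f v0 v1 v2 \<longleftrightarrow> (\<exists>f'. (\<forall>t. (f has_real_derivative f' t) (at t))
     \<and> (f' has_real_derivative v2) (at 0) \<and> f 0 = v0 \<and> f' 0 = v1)"

lemma has_jet2_add:
  assumes "has_jet2 f a0 a1 a2" "has_jet2 g b0 b1 b2"
  shows "has_jet2 (\<lambda>t. f t + g t) (a0 + b0) (a1 + b1) (a2 + b2)"
proof -
  obtain f' g' where "\<forall>t. (f has_real_derivative f' t) (at t)" "(f' has_real_derivative a2) (at 0)"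
    "f 0 = a0" "f' 0 = a1" "\<forall>t. (g has_real_derivative g' t) (at t)"
    "(g' has_real_derivative b2) (at 0)" "g 0 = b0" "g' 0 = b1"
    using assms unfolding has_jet2_def by blast
  then show ?thesis
    unfolding has_jet2_def by (intro exI[of _ "\<lambda>t. f' t + g' t"]) (auto intro: DERIV_add)
qed

text \<open>In the application the quadratic polynomial is the squared length of a vector that moves linearly, and
  \<open>w\<close>, with logarithmic derivative \<open>\<Psi>\<close>, is its weight, run at the speed \<open>c = \<phi>(\<theta>)\<close>.\<close>

lemma has_jet2_weight:
  assumes w: "\<And>\<tau>. (w has_real_derivative w \<tau> * \<Psi> \<tau>) (at \<tau>)" "w 0 = 1"
    and \<Psi>: "(\<Psi> has_real_derivative \<Psi>') (at 0)"
  shows "has_jet2 (\<lambda>t. w (t * c) * (b0 + b1 * t + b2 * t\<^sup>2)) b0 (c * \<Psi> 0 * b0 + b1)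
     (c\<^sup>2 * ((\<Psi> 0)\<^sup>2 + \<Psi>') * b0 + 2 * c * \<Psi> 0 * b1 + 2 * b2)"
proof -
  have w': "((\<lambda>t. w (t * c)) has_real_derivative w (t * c) * \<Psi> (t * c) * c) (at t)" for t
    by (rule DERIV_chain2[where f = w and g = "\<lambda>t. t * c"]) (auto intro!: derivative_eq_intros w(1))
  have "((\<lambda>t. \<Psi> (t * c)) has_real_derivative \<Psi>' * c) (at 0)"
    by (rule DERIV_chain2[where f = \<Psi> and g = "\<lambda>t. t * c"]) (auto intro!: derivative_eq_intros \<Psi>)
  note d = w' this
  show ?thesis
    unfolding has_jet2_def
  proof (intro exI[of _ "\<lambda>t. w (t * c) * (c * \<Psi> (t * c) * (b0 + b1 * t + b2 * t\<^sup>2) + (b1 + 2 * b2 * t))"]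
      conjI allI)
    show "((\<lambda>t. w (t * c) * (b0 + b1 * t + b2 * t\<^sup>2)) has_real_derivative
       w (t * c) * (c * \<Psi> (t * c) * (b0 + b1 * t + b2 * t\<^sup>2) + (b1 + 2 * b2 * t))) (at t)" for t
      by (rule derivative_eq_intros d refl)+ (simp add: algebra_simps)
    show "((\<lambda>t. w (t * c) * (c * \<Psi> (t * c) * (b0 + b1 * t + b2 * t\<^sup>2) + (b1 + 2 * b2 * t)))
       has_real_derivative c\<^sup>2 * ((\<Psi> 0)\<^sup>2 + \<Psi>') * b0 + 2 * c * \<Psi> 0 * b1 + 2 * b2) (at 0)"
      by (rule derivative_eq_intros d refl)+ (simp add: algebra_simps power2_eq_square w(2))
  qed (simp_all add: w(2))
qed

text \<open>Near 0 the radicand is positive, so the first derivative is given there by the usual formula, which can be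
  differentiated again.\<close>

lemma deriv_sqrt_jet2:
  assumes "has_jet2 q 1 v1 v2"
  shows "deriv (\<lambda>t. sqrt (q t)) 0 = v1 / 2"
    and "deriv (deriv (\<lambda>t. sqrt (q t))) 0 = v2 / 2 - v1\<^sup>2 / 4"
proof -
  obtain q' where q: "\<And>t. (q has_real_derivative q' t) (at t)" "(q' has_real_derivative v2) (at 0)"
    "q 0 = 1" "q' 0 = v1"
    using assms unfolding has_jet2_def by blast
  have D: "((\<lambda>t. sqrt (q t)) has_real_derivative q' t / (2 * sqrt (q t))) (at t)" if "q t > 0" for t
    using that by (auto intro!: derivative_eq_intros q(1) simp: field_simps)
  show "deriv (\<lambda>t. sqrt (q t)) 0 = v1 / 2"
    using DERIV_imp_deriv[OF D[of 0]] q by simp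
  have "isCont q 0" using q(1) by (rule DERIV_isCont)
  then have "(q \<longlongrightarrow> q 0) (nhds 0)"
    unfolding isCont_def tendsto_at_iff_tendsto_nhds .
  then have "\<forall>\<^sub>F t in nhds 0. q t > 0"
    by (rule order_tendstoD(1)) (simp add: q(3))
  then have ev: "\<forall>\<^sub>F t in nhds 0. deriv (\<lambda>t. sqrt (q t)) t = q' t / (2 * sqrt (q t))"
    by eventually_elim (rule DERIV_imp_deriv[OF D])
  have "((\<lambda>t. q' t / (2 * sqrt (q t))) has_real_derivative v2 / 2 - v1\<^sup>2 / 4) (at 0)"
    by (rule derivative_eq_intros q(2) D refl | simp add: q)+ (simp add: q power2_eq_square)
  then have "deriv (\<lambda>t. q' t / (2 * sqrt (q t))) 0 = v2 / 2 - v1\<^sup>2 / 4"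
    by (rule DERIV_imp_deriv)
  then show "deriv (deriv (\<lambda>t. sqrt (q t))) 0 = v2 / 2 - v1\<^sup>2 / 4"
    using deriv_cong_ev[OF ev refl] by simp
qed

text \<open>As functions of \<open>X = sinh\<^sup>2 s\<close>: the logarithmic \<open>\<tau>\<close>-derivatives of the weights of the radial component
  and of the two eigenspaces (see \<open>DERIV_weights\<close>), and the speed of \<open>X\<close> itself (see \<open>DERIV_sinh_sq\<close>).\<close>

definition rateN :: "real \<Rightarrow> real" where
  "rateN X = 2 * (15 + 22 * X) * Lpol X / (165 * (1 + X) ^ 4)"

definition rateH :: "real \<Rightarrow> real" where
  "rateH X = 32 - 2 * Lpol X / (165 * (1 + X) ^ 3)"

definition rateV :: "real \<Rightarrow> real" where
  "rateV X = 32 - 2 * (1 + 2 * X) * Lpol X / (165 * (1 + X) ^ 4)"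

definition Xspeed :: "real \<Rightarrow> real" where
  "Xspeed X = 2 * X * Lpol X / (165 * (1 + X) ^ 3)"

definition Lder :: "real \<Rightarrow> real" where "Lder X = 360 * X\<^sup>2 + 792 * X + 440"

lemma DERIV_Lpol: "(Lpol has_real_derivative Lder X) (at X within S)"
  unfolding Lpol_def Lder_def by (auto intro!: derivative_eq_intros)

definition rateN' :: "real \<Rightarrow> real" where
  "rateN' X = 2 * ((22 * Lpol X + (15 + 22 * X) * Lder X) * (1 + X) - 4 * (15 + 22 * X) * Lpol X) / (165 * (1 + X) ^ 5)"

definition rateH' :: "real \<Rightarrow> real" where
  "rateH' X = - 2 * (Lder X * (1 + X) - 3 * Lpol X) / (165 * (1 + X) ^ 4)"

definition rateV' :: "real \<Rightarrow> real" where
  "rateV' X = - 2 * ((2 * Lpol X + (1 + 2 * X) * Lder X) * (1 + X) - 4 * (1 + 2 * X) * Lpol X) / (165 * (1 + X) ^ 5)"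

lemma DERIV_rates:
  assumes "X \<ge> 0"
  shows "(rateN has_real_derivative rateN' X) (at X)"
    and "(rateH has_real_derivative rateH' X) (at X)"
    and "(rateV has_real_derivative rateV' X) (at X)"
proof -
  have u: "1 + X \<noteq> 0" using assms by simp
  have scaled: "((\<lambda>X. N X / (165 * (1 + X) ^ n)) has_real_derivative
      (N' * (1 + X) - of_nat n * N X) / (165 * (1 + X) ^ Suc n)) (at X)"
    if N: "(N has_real_derivative N') (at X)" and n: "n > 0" for N N' n
  proof -
    obtain m where m: "n = Suc m" using n gr0_implies_Suc by blast
    show ?thesis
      using u unfolding m
      by (auto intro!: derivative_eq_intros N simp: divide_simps)
         (cases m; simp add: algebra_simps)
  qed
  have N: "((\<lambda>X. 2 * (15 + 22 * X) * Lpol X) has_real_derivative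
      2 * (22 * Lpol X + (15 + 22 * X) * Lder X)) (at X)"
    by (auto intro!: derivative_eq_intros DERIV_Lpol simp: algebra_simps)
  show "(rateN has_real_derivative rateN' X) (at X)"
    unfolding rateN_def rateN'_def
    by (rule DERIV_cong[OF scaled[OF N]]) (simp_all add: algebra_simps)
  have H: "((\<lambda>X. 2 * Lpol X) has_real_derivative 2 * Lder X) (at X)"
    by (auto intro!: derivative_eq_intros DERIV_Lpol)
  show "(rateH has_real_derivative rateH' X) (at X)"
    unfolding rateH_def rateH'_def
    by (rule DERIV_cong[OF DERIV_diff[OF DERIV_const scaled[OF H]]]) (simp_all add: algebra_simps minus_divide_left)
  have V: "((\<lambda>X. 2 * (1 + 2 * X) * Lpol X) has_real_derivative
      2 * (2 * Lpol X + (1 + 2 * X) * Lder X)) (at X)"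
    by (auto intro!: derivative_eq_intros DERIV_Lpol simp: algebra_simps)
  show "(rateV has_real_derivative rateV' X) (at X)"
    unfolding rateV_def rateV'_def
    by (rule DERIV_cong[OF DERIV_diff[OF DERIV_const scaled[OF V]]]) (simp_all add: algebra_simps minus_divide_left)
qed

lemma sinh_radial_speed: "2 * sinh s * cosh s * radial_speed s = Xspeed ((sinh s)\<^sup>2)"
  by (simp add: radial_speed_def Xspeed_def cosh_even_powers(2) power2_eq_square)

text \<open>After clearing denominators this is the differential equation
  \<open>8 L + X L' = 1320 (1 + X)\<^sup>3\<close> that expresses \<open>(X\<^sup>8 L)' = 1320 X\<^sup>7 (1 + X)\<^sup>3\<close>.\<close>

lemma DERIV_radial_speed:
  "(radial_speed has_real_derivative 16 - rateN ((sinh s)\<^sup>2) / 2) (at s)"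
proof -
  let ?X = "(sinh s)\<^sup>2"
  have c: "cosh s \<noteq> 0" and u: "1 + ?X > 0" using cosh_real_pos[of s] by (auto simp: add_pos_nonneg)
  have "((\<lambda>s. sinh s * Lpol ((sinh s)\<^sup>2) / (165 * cosh s ^ 7)) has_real_derivative
      ((cosh s * Lpol ?X + sinh s * (Lder ?X * (2 * sinh s * cosh s))) * (165 * cosh s ^ 7)
        - sinh s * Lpol ?X * (165 * (7 * cosh s ^ 6 * sinh s))) / ((165 * cosh s ^ 7) * (165 * cosh s ^ 7))) (at s)"
    by (rule derivative_eq_intros DERIV_chain2[OF DERIV_Lpol] refl | simp)+
  also have "((cosh s * Lpol ?X + sinh s * (Lder ?X * (2 * sinh s * cosh s))) * (165 * cosh s ^ 7)
        - sinh s * Lpol ?X * (165 * (7 * cosh s ^ 6 * sinh s))) / ((165 * cosh s ^ 7) * (165 * cosh s ^ 7))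
     = ((Lpol ?X + 2 * ?X * Lder ?X) * (cosh s)\<^sup>2 - 7 * ?X * Lpol ?X) / (165 * ((cosh s)\<^sup>2) ^ 4)"
    using c by (simp add: divide_simps) (simp add: algebra_simps eval_nat_numeral)
  also have "\<dots> = 16 - rateN ?X / 2"
  proof -
    have "((L + 2 * X * L') * (1 + X) - 7 * X * L) / (165 * (1 + X) ^ 4)
       = 16 - 2 * (15 + 22 * X) * L / (165 * (1 + X) ^ 4) / 2"
      if "L = Lpol X" "L' = Lder X" "1 + X > 0" for L L' X
    proof -
      have "(L + 2 * X * L') * (1 + X) - 7 * X * L = 16 * (165 * (1 + X) ^ 4) - (15 + 22 * X) * L"
        unfolding that Lpol_def Lder_def by algebra
      then show ?thesis using that(3) by (simp add: divide_simps)
    qed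
    from this[OF refl refl u] show ?thesis
      unfolding cosh_even_powers(1) rateN_def .
  qed
  finally show ?thesis unfolding radial_speed_def[abs_def] .
qed

definition sinh_sq :: "real \<Rightarrow> real \<Rightarrow> real" where
  "sinh_sq r \<tau> = (sinh (dilated_radius r \<tau>))\<^sup>2"

text \<open>The factors by which the deformation at constant \<open>\<phi>\<close> multiplies the three parts of the squared
  Jacobian; \<open>exp (32 \<tau>)\<close> is the square of its determinant.\<close>

definition weightN :: "real \<Rightarrow> real \<Rightarrow> real" where
  "weightN r \<tau> = exp (32 * \<tau>) * (radial_speed r / radial_speed (dilated_radius r \<tau>))\<^sup>2"

definition weightH :: "real \<Rightarrow> real \<Rightarrow> real" where
  "weightH r \<tau> = exp (32 * \<tau>) * (sinh r / sinh (dilated_radius r \<tau>))\<^sup>2"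

definition weightV :: "real \<Rightarrow> real \<Rightarrow> real" where
  "weightV r \<tau> = exp (32 * \<tau>) *
     ((sinh r * cosh r) / (sinh (dilated_radius r \<tau>) * cosh (dilated_radius r \<tau>)))\<^sup>2"

lemma DERIV_exp_div_square:
  fixes f :: "real \<Rightarrow> real"
  assumes "(f has_real_derivative f') (at \<tau>)" "f \<tau> \<noteq> 0" "32 - 2 * (f' / f \<tau>) = \<rho>"
  shows "((\<lambda>\<tau>. exp (32 * \<tau>) * (c / f \<tau>)\<^sup>2) has_real_derivative exp (32 * \<tau>) * (c / f \<tau>)\<^sup>2 * \<rho>) (at \<tau>)"
  unfolding assms(3)[symmetric] using assms(2)
  by (auto intro!: derivative_eq_intros assms(1)) (simp add: field_simps power2_eq_square)

context
  fixes r :: real assumes r: "r > 0"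
begin

lemma DERIV_sinh_sq: "(sinh_sq r has_real_derivative Xspeed (sinh_sq r \<tau>)) (at \<tau>)"
  unfolding sinh_sq_def[abs_def]
  by (rule derivative_eq_intros DERIV_dilated_radius[OF r] refl)+
     (simp add: sinh_radial_speed[symmetric])

lemma weights_0: "weightN r 0 = 1" "weightH r 0 = 1" "weightV r 0 = 1"
  using r radial_speed_pos[OF r]
  by (simp_all add: weightN_def weightH_def weightV_def dilated_radius_0)

lemma DERIV_weights:
  "(weightN r has_real_derivative weightN r \<tau> * rateN (sinh_sq r \<tau>)) (at \<tau>)"
  "(weightH r has_real_derivative weightH r \<tau> * rateH (sinh_sq r \<tau>)) (at \<tau>)"
  "(weightV r has_real_derivative weightV r \<tau> * rateV (sinh_sq r \<tau>)) (at \<tau>)"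
proof -
  let ?s = "dilated_radius r \<tau>"
  have s: "?s > 0" by (rule dilated_radius_pos[OF r])
  have k: "radial_speed ?s > 0" using s by (rule radial_speed_pos)
  have c: "cosh ?s \<noteq> 0" by (simp add: less_imp_neq[OF cosh_real_pos, symmetric])
  note D = DERIV_dilated_radius[OF r, of \<tau>]
  show "(weightN r has_real_derivative weightN r \<tau> * rateN (sinh_sq r \<tau>)) (at \<tau>)"
    unfolding weightN_def[abs_def] sinh_sq_def
    by (rule DERIV_exp_div_square[OF DERIV_chain2[OF DERIV_radial_speed D]]) (use k in auto)
  show "(weightH r has_real_derivative weightH r \<tau> * rateH (sinh_sq r \<tau>)) (at \<tau>)"
    unfolding weightH_def[abs_def] sinh_sq_def
  proof (rule DERIV_exp_div_square)
    show "((\<lambda>\<tau>. sinh (dilated_radius r \<tau>)) has_real_derivative cosh ?s * radial_speed ?s) (at \<tau>)"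
      by (rule derivative_eq_intros D refl)+
    show "32 - 2 * (cosh ?s * radial_speed ?s / sinh ?s) = rateH ((sinh ?s)\<^sup>2)"
      using s c by (simp add: rateH_def radial_speed_def cosh_even_powers(2))
  qed (use s in simp)
  show "(weightV r has_real_derivative weightV r \<tau> * rateV (sinh_sq r \<tau>)) (at \<tau>)"
    unfolding weightV_def[abs_def] sinh_sq_def
  proof (rule DERIV_exp_div_square)
    show "((\<lambda>\<tau>. sinh (dilated_radius r \<tau>) * cosh (dilated_radius r \<tau>)) has_real_derivative
       ((sinh ?s)\<^sup>2 + (cosh ?s)\<^sup>2) * radial_speed ?s) (at \<tau>)"
      by (rule derivative_eq_intros D refl)+ (simp add: algebra_simps power2_eq_square)
    have "((sinh ?s)\<^sup>2 + (cosh ?s)\<^sup>2) * radial_speed ?s / (sinh ?s * cosh ?s)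
      = ((sinh ?s)\<^sup>2 + (cosh ?s)\<^sup>2) * Lpol ((sinh ?s)\<^sup>2) / (165 * ((cosh ?s)\<^sup>2) ^ 4)"
      using s c by (simp add: radial_speed_def eval_nat_numeral)
    then show "32 - 2 * (((sinh ?s)\<^sup>2 + (cosh ?s)\<^sup>2) * radial_speed ?s / (sinh ?s * cosh ?s)) = rateV ((sinh ?s)\<^sup>2)"
      by (simp add: rateV_def cosh_even_powers(1))
  qed (use s c in simp)
qed

end

text \<open>The squared Jacobian is a sum of three weighted squared lengths with value 1 at \<open>t = 0\<close>, so
  \<open>has_jet2_weight\<close> and \<open>deriv_sqrt_jet2\<close> apply. The terms \<open>Hb\<close> and \<open>Vb\<close> come from the derivative of the cross terms with the
  gradient.\<close>

lemma jac_jet2: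
  fixes \<theta> \<nu> a :: cayley and b r :: real
  assumes unit: "norm \<theta> = 1" and r: "r > 0"
  defines "x \<equiv> (sinh r)\<^sup>2" and "k \<equiv> radial_speed r" and "\<alpha> \<equiv> \<nu> \<bullet> \<theta>" and "c \<equiv> \<theta> \<bullet> a + b"
  defines "\<beta> \<equiv> (sinh r / r)\<^sup>2 * (norm (Hproj \<theta> \<nu>))\<^sup>2" and "\<gamma> \<equiv> (sinh r * cosh r / r)\<^sup>2 * (norm (Vproj \<theta> \<nu>))\<^sup>2"
  assumes norm: "\<alpha>\<^sup>2 + \<beta> + \<gamma> = 1"
  defines "S \<equiv> \<alpha>\<^sup>2 * rateN x + \<beta> * rateH x + \<gamma> * rateV x"
  defines "Hb \<equiv> - 2 * \<alpha> * k / r * (Hproj \<theta> \<nu> \<bullet> a)" and "Vb \<equiv> - 2 * \<alpha> * k / r * (Vproj \<theta> \<nu> \<bullet> a)"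
  shows "deriv (jac (r *\<^sub>R \<theta>) \<nu> (\<lambda>\<omega>. \<omega> \<bullet> a + b)) 0 = (c * S + Hb + Vb) / 2"
    and "deriv (deriv (jac (r *\<^sub>R \<theta>) \<nu> (\<lambda>\<omega>. \<omega> \<bullet> a + b))) 0 =
      (c\<^sup>2 * (\<alpha>\<^sup>2 * ((rateN x)\<^sup>2 + rateN' x * Xspeed x) + \<beta> * ((rateH x)\<^sup>2 + rateH' x * Xspeed x)
           + \<gamma> * ((rateV x)\<^sup>2 + rateV' x * Xspeed x))
        + 2 * c * (rateH x * Hb + rateV x * Vb)
        + 2 * (\<alpha>\<^sup>2 * k\<^sup>2 / x * (norm (Hproj \<theta> a))\<^sup>2 + \<alpha>\<^sup>2 * k\<^sup>2 / (x * (1 + x)) * (norm (Vproj \<theta> a))\<^sup>2)) / 2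
      - (c * S + Hb + Vb)\<^sup>2 / 4"
proof -
  define Q where "Q t = weightN r (t * c) * (\<alpha>\<^sup>2 + 0 * t + 0 * t\<^sup>2)
     + weightH r (t * c) * (\<beta> + Hb * t + (\<alpha>\<^sup>2 * k\<^sup>2 / x * (norm (Hproj \<theta> a))\<^sup>2) * t\<^sup>2)
     + weightV r (t * c) * (\<gamma> + Vb * t + (\<alpha>\<^sup>2 * k\<^sup>2 / (x * (1 + x)) * (norm (Vproj \<theta> a))\<^sup>2) * t\<^sup>2)" for t
  have x: "x > 0" and c: "cosh r > 0" using r by (simp_all add: x_def)
  \<comment> \<open>Either weighted squared length as a quadratic polynomial in \<open>t\<close>: \<open>p\<close> is \<open>sinh r / r\<close> or
    \<open>sinh r cosh r / r\<close>, and the factor \<open>(p r)\<^sup>2\<close> clears its denominators.\<close>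
  have square: "(p\<^sup>2 * (norm h)\<^sup>2 + B * t + (\<alpha>\<^sup>2 * k\<^sup>2 / (p * r)\<^sup>2 * (norm h')\<^sup>2) * t\<^sup>2) * (p * r)\<^sup>2 
      = r\<^sup>2 * (norm (p\<^sup>2 *\<^sub>R h - (\<alpha> * t * k / r) *\<^sub>R h'))\<^sup>2"
    if "p > 0" "B = - 2 * \<alpha> * k / r * (h \<bullet> h')" for p B t and h h' :: cayley
    using that(1) r unfolding power2_norm_eq_inner that(2)
    by (simp add: inner_diff_left inner_diff_right inner_commute[of h' h] field_simps power2_eq_square)
  have inner: "Hproj \<theta> \<nu> \<bullet> a = Hproj \<theta> \<nu> \<bullet> Hproj \<theta> a" "Vproj \<theta> \<nu> \<bullet> a = Vproj \<theta> \<nu> \<bullet> Vproj \<theta> a"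
    by (metis Hproj_selfadjoint HV_compose(1) unit) (metis Vproj_selfadjoint HV_compose(4) unit)
  have J: "jac (r *\<^sub>R \<theta>) \<nu> (\<lambda>\<omega>. \<omega> \<bullet> a + b) = (\<lambda>t. sqrt (Q t))"
  proof (rule ext)
    fix t
    let ?s = "dilated_radius r (t * c)"
    have s: "sinh ?s > 0" using dilated_radius_pos[OF r] by simp
    have "weightN r (t * c) * (\<alpha>\<^sup>2 + 0 * t + 0 * t\<^sup>2) = exp (32 * (t * c)) * (\<alpha> * k / radial_speed ?s)\<^sup>2"
      by (simp add: weightN_def k_def power_mult_distrib power_divide)
    moreover have "weightH r (t * c) * (\<beta> + Hb * t + (\<alpha>\<^sup>2 * k\<^sup>2 / x * (norm (Hproj \<theta> a))\<^sup>2) * t\<^sup>2)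
      = exp (32 * (t * c)) * ((r / sinh ?s)\<^sup>2 * (norm ((sinh r / r)\<^sup>2 *\<^sub>R Hproj \<theta> \<nu> - (\<alpha> * t * k / r) *\<^sub>R Hproj \<theta> a))\<^sup>2)"
      using square[of "sinh r / r" Hb "Hproj \<theta> \<nu>" "Hproj \<theta> a" t] r
      by (simp add: weightH_def \<beta>_def x_def Hb_def inner power_divide mult.commute[of _ "(sinh r)\<^sup>2"])
    moreover have "weightV r (t * c) * (\<gamma> + Vb * t + (\<alpha>\<^sup>2 * k\<^sup>2 / (x * (1 + x)) * (norm (Vproj \<theta> a))\<^sup>2) * t\<^sup>2)
      = exp (32 * (t * c)) * ((r / (sinh ?s * cosh ?s))\<^sup>2
          * (norm ((sinh r * cosh r / r)\<^sup>2 *\<^sub>R Vproj \<theta> \<nu> - (\<alpha> * t * k / r) *\<^sub>R Vproj \<theta> a))\<^sup>2)"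
    proof -
      have "x * (1 + x) = (sinh r * cosh r / r * r)\<^sup>2"
        using r by (simp add: x_def cosh_even_powers(1) power_mult_distrib)
      then show ?thesis
        using square[of "sinh r * cosh r / r" Vb "Vproj \<theta> \<nu>" "Vproj \<theta> a" t] r
        by (simp add: weightV_def \<gamma>_def Vb_def inner power_divide
            mult.commute[of _ "(sinh r * cosh r)\<^sup>2"])
    qed
    ultimately show "jac (r *\<^sub>R \<theta>) \<nu> (\<lambda>\<omega>. \<omega> \<bullet> a + b) t = sqrt (Q t)"
      unfolding jac_polar[OF unit r] Q_def c_def[symmetric] k_def[symmetric] \<alpha>_def[symmetric]
      by (simp only: distrib_left)
  qed
  have X: "sinh_sq r 0 = x" by (simp add: sinh_sq_def dilated_radius_0[OF r] x_def)
  have rate: "((\<lambda>\<tau>. R (sinh_sq r \<tau>)) has_real_derivative R' * Xspeed x) (at 0)"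
    if "(R has_real_derivative R') (at x)" for R R'
    using DERIV_chain2[of R R' "sinh_sq r" 0 "Xspeed x" UNIV] that DERIV_sinh_sq[OF r, of 0]
    by (simp add: X)
  note rates = DERIV_rates[OF less_imp_le[OF x]]
  have jet: "has_jet2 Q (\<alpha>\<^sup>2 + \<beta> + \<gamma>)
     ((c * rateN x * \<alpha>\<^sup>2 + 0) + (c * rateH x * \<beta> + Hb) + (c * rateV x * \<gamma> + Vb))
     ((c\<^sup>2 * ((rateN x)\<^sup>2 + rateN' x * Xspeed x) * \<alpha>\<^sup>2 + 2 * c * rateN x * 0 + 2 * 0)
       + (c\<^sup>2 * ((rateH x)\<^sup>2 + rateH' x * Xspeed x) * \<beta> + 2 * c * rateH x * Hb
           + 2 * (\<alpha>\<^sup>2 * k\<^sup>2 / x * (norm (Hproj \<theta> a))\<^sup>2))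
       + (c\<^sup>2 * ((rateV x)\<^sup>2 + rateV' x * Xspeed x) * \<gamma> + 2 * c * rateV x * Vb
           + 2 * (\<alpha>\<^sup>2 * k\<^sup>2 / (x * (1 + x)) * (norm (Vproj \<theta> a))\<^sup>2)))"
    unfolding Q_def
    by (intro has_jet2_add
        has_jet2_weight[where \<Psi> = "\<lambda>\<tau>. rateN (sinh_sq r \<tau>)", OF DERIV_weights(1)[OF r] weights_0(1)[OF r] rate[OF rates(1)], unfolded X]
        has_jet2_weight[where \<Psi> = "\<lambda>\<tau>. rateH (sinh_sq r \<tau>)", OF DERIV_weights(2)[OF r] weights_0(2)[OF r] rate[OF rates(2)], unfolded X]
        has_jet2_weight[where \<Psi> = "\<lambda>\<tau>. rateV (sinh_sq r \<tau>)", OF DERIV_weights(3)[OF r] weights_0(3)[OF r] rate[OF rates(3)], unfolded X])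
  note jet = jet[unfolded norm]
  show "deriv (jac (r *\<^sub>R \<theta>) \<nu> (\<lambda>\<omega>. \<omega> \<bullet> a + b)) 0 = (c * S + Hb + Vb) / 2"
    unfolding J deriv_sqrt_jet2(1)[OF jet] by (simp add: S_def algebra_simps)
  have S: "c * rateN x * \<alpha>\<^sup>2 + 0 + (c * rateH x * \<beta> + Hb) + (c * rateV x * \<gamma> + Vb) = c * S + Hb + Vb"
    by (simp add: S_def algebra_simps)
  show "deriv (deriv (jac (r *\<^sub>R \<theta>) \<nu> (\<lambda>\<omega>. \<omega> \<bullet> a + b))) 0 =
      (c\<^sup>2 * (\<alpha>\<^sup>2 * ((rateN x)\<^sup>2 + rateN' x * Xspeed x) + \<beta> * ((rateH x)\<^sup>2 + rateH' x * Xspeed x)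
           + \<gamma> * ((rateV x)\<^sup>2 + rateV' x * Xspeed x))
        + 2 * c * (rateH x * Hb + rateV x * Vb)
        + 2 * (\<alpha>\<^sup>2 * k\<^sup>2 / x * (norm (Hproj \<theta> a))\<^sup>2 + \<alpha>\<^sup>2 * k\<^sup>2 / (x * (1 + x)) * (norm (Vproj \<theta> a))\<^sup>2)) / 2
      - (c * S + Hb + Vb)\<^sup>2 / 4"
    unfolding J deriv_sqrt_jet2(2)[OF jet] S
    by (rule arg_cong2[where f = "(-)"]) (simp_all only: mult_zero_left mult_zero_right add_0_left add_0_right distrib_left mult.assoc ac_simps)
qed

section \<open>The trace\<close>

text \<open>Over the common denominator \<open>165\<^sup>2 (1 + x)\<^sup>8\<close> both sides are quadratic forms in \<open>\<beta>\<close>, \<open>\<gamma>\<close>, \<open>\<delta>\<close> once the terms of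
  degree one are multiplied by \<open>1 = \<delta> + \<beta> + \<gamma>\<close>. The six coefficients are compared one at a time, as polynomials
  in \<open>x\<close>; that of \<open>\<delta>\<^sup>2\<close> vanishes.\<close>

lemma trace_rational_identity:
  fixes x \<beta> \<gamma> :: real
  assumes x: "x \<ge> 0"
  defines "\<delta> \<equiv> 1 - \<beta> - \<gamma>"
  defines "S \<equiv> \<delta> * rateN x + \<beta> * rateH x + \<gamma> * rateV x"
    and "K \<equiv> (Lpol x)\<^sup>2 / (27225 * (1 + x) ^ 7)"
  shows "(\<delta> * ((rateN x)\<^sup>2 + rateN' x * Xspeed x) + \<beta> * ((rateH x)\<^sup>2 + rateH' x * Xspeed x)
           + \<gamma> * ((rateV x)\<^sup>2 + rateV' x * Xspeed x)
        + 2 * (\<delta> * K * 8 + \<delta> * (K / (1 + x)) * 7)) / 2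
      - (S\<^sup>2 + 4 * \<delta> * (K * \<beta> + K / (1 + x) * \<gamma>)) / 4 - 8 * S
    = - (Ppol x \<beta> \<gamma> / (27225 * (1 + x) ^ 8))"
proof -
  define u where "u = 1 + x"
  have u: "u > 0" using x by (simp add: u_def)
  define L M where LM: "L = Lpol x" "M = Lder x"
  \<comment> \<open>The numerators of the rates over \<open>165 u\<^sup>4\<close>, and below, with primes, those of their \<open>\<tau>\<close>-derivatives over
    \<open>165\<^sup>2 u\<^sup>8\<close>.\<close>
  define n h v where nhv: "n = 2 * (15 + 22 * x) * L" "h = 5280 * u ^ 4 - 2 * L * u"
    "v = 5280 * u ^ 4 - 2 * (1 + 2 * x) * L"
  define n' h' v' where nhv': "n' = 4 * x * L * ((22 * L + (15 + 22 * x) * M) * u - 4 * (15 + 22 * x) * L)"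
    "h' = - 4 * x * L * (M * u - 3 * L) * u"
    "v' = - 4 * x * L * ((2 * L + (1 + 2 * x) * M) * u - 4 * (1 + 2 * x) * L)"
  let ?D = "27225 * u ^ 8"
  have rates: "rateN x = n / (165 * u ^ 4)" "rateH x = h / (165 * u ^ 4)" "rateV x = v / (165 * u ^ 4)"
    using u by (simp_all add: rateN_def rateH_def rateV_def u_def[symmetric] LM nhv divide_simps eval_nat_numeral left_diff_distrib)
  have rates': "rateN' x * Xspeed x = n' / ?D" "rateH' x * Xspeed x = h' / ?D" "rateV' x * Xspeed x = v' / ?D"
    using u by (simp_all add: rateN'_def rateH'_def rateV'_def Xspeed_def u_def[symmetric] LM nhv' divide_simps eval_nat_numeral)
      (simp_all add: algebra_simps)
  have K: "K = L\<^sup>2 * u / ?D" "K / (1 + x) = L\<^sup>2 / ?D"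
    using u by (simp_all add: K_def LM u_def[symmetric] divide_simps eval_nat_numeral)
  define s where "s = \<delta> * n + \<beta> * h + \<gamma> * v"
  have S: "S = s / (165 * u ^ 4)"
    by (simp add: S_def rates s_def add_divide_distrib)
  have sq: "(y / (165 * u ^ 4))\<^sup>2 = y\<^sup>2 / ?D" for y
    by (simp add: power_divide power_mult_distrib flip: power_mult)
  have lin: "y / (165 * u ^ 4) = 165 * u ^ 4 * y / ?D" for y
    using u by (simp add: divide_simps eval_nat_numeral)
  have num: "(\<delta> * (n\<^sup>2 + n') + \<beta> * (h\<^sup>2 + h') + \<gamma> * (v\<^sup>2 + v') + 2 * (\<delta> * (L\<^sup>2 * u) * 8 + \<delta> * L\<^sup>2 * 7)) / 2
      - (s\<^sup>2 + 4 * \<delta> * (L\<^sup>2 * u * \<beta> + L\<^sup>2 * \<gamma>)) / 4 - 8 * (165 * u ^ 4 * s) = - Ppol x \<beta> \<gamma>"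
  proof -
    note defs = nhv nhv' LM u_def Lpol_def Lder_def
    \<comment> \<open>This is the vanishing of the coefficient of \<open>\<delta>\<^sup>2\<close>, solved for \<open>n'\<close>.\<close>
    have NN: "n' = 2640 * u ^ 4 * n - n\<^sup>2 / 2 - 2 * (L\<^sup>2 * u * 8 + L\<^sup>2 * 7)"
      unfolding defs by algebra
    have HH: "B20 x = - ((h\<^sup>2 + h') / 2 - h\<^sup>2 / 4 - 1320 * u ^ 4 * h)"
      unfolding defs B20_def by algebra
    have VV: "B02 x = - ((v\<^sup>2 + v') / 2 - v\<^sup>2 / 4 - 1320 * u ^ 4 * v)"
      unfolding defs B02_def by algebra
    have HV: "B11 x = - ((h\<^sup>2 + h' + (v\<^sup>2 + v')) / 2 - h * v / 2 - 1320 * u ^ 4 * (h + v))"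
      unfolding defs B11_def by algebra
    have NH: "B10 x = - ((n\<^sup>2 + n' + 2 * (L\<^sup>2 * u * 8 + L\<^sup>2 * 7) + (h\<^sup>2 + h')) / 2 - n * h / 2 - L\<^sup>2 * u
        - 1320 * u ^ 4 * (n + h))"
      unfolding defs B10_def by algebra
    have NV: "B01 x = - ((n\<^sup>2 + n' + 2 * (L\<^sup>2 * u * 8 + L\<^sup>2 * 7) + (v\<^sup>2 + v')) / 2 - n * v / 2 - L\<^sup>2
        - 1320 * u ^ 4 * (n + v))"
      unfolding defs B01_def by algebra
    have one: "\<delta> + \<beta> + \<gamma> = 1" by (simp add: \<delta>_def)
    have "((\<delta> * (n\<^sup>2 + n') + \<beta> * (h\<^sup>2 + h') + \<gamma> * (v\<^sup>2 + v')
           + 2 * (\<delta> * (L\<^sup>2 * u) * 8 + \<delta> * L\<^sup>2 * 7)) / 2 - 8 * (165 * u ^ 4 * s)) * (\<delta> + \<beta> + \<gamma>)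
      - (s\<^sup>2 + 4 * \<delta> * (L\<^sup>2 * u * \<beta> + L\<^sup>2 * \<gamma>)) / 4 = - Ppol x \<beta> \<gamma>"
      unfolding s_def Ppol_def Let_def \<delta>_def[symmetric]
      unfolding HH VV HV NH NV NN by (simp add: field_simps power2_eq_square)
    then show ?thesis unfolding one by (simp only: mult_1_right diff_right_commute)
  qed
  have "(\<delta> * ((rateN x)\<^sup>2 + rateN' x * Xspeed x) + \<beta> * ((rateH x)\<^sup>2 + rateH' x * Xspeed x)
           + \<gamma> * ((rateV x)\<^sup>2 + rateV' x * Xspeed x)
        + 2 * (\<delta> * K * 8 + \<delta> * (K / (1 + x)) * 7)) / 2
      - (S\<^sup>2 + 4 * \<delta> * (K * \<beta> + K / (1 + x) * \<gamma>)) / 4 - 8 * S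
     = ((\<delta> * (n\<^sup>2 + n') + \<beta> * (h\<^sup>2 + h') + \<gamma> * (v\<^sup>2 + v') + 2 * (\<delta> * (L\<^sup>2 * u) * 8 + \<delta> * L\<^sup>2 * 7)) / 2
      - (s\<^sup>2 + 4 * \<delta> * (L\<^sup>2 * u * \<beta> + L\<^sup>2 * \<gamma>)) / 4 - 8 * (165 * u ^ 4 * s)) / ?D"
    unfolding rates' K(2) S unfolding K(1) rates sq unfolding lin[of s]
    by (simp add: add_divide_distrib diff_divide_distrib distrib_left mult_ac)
  also have "\<dots> = - Ppol x \<beta> \<gamma> / ?D" unfolding num ..
  finally show ?thesis by (simp add: u_def)
qed

lemma Ppol_sign:
  assumes "x > 0" "\<beta> \<ge> 0" "\<gamma> \<ge> 0" "\<beta> + \<gamma> \<le> 1"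
  shows "Ppol x \<beta> \<gamma> \<ge> 0" "Ppol x \<beta> \<gamma> = 0 \<longleftrightarrow> \<beta> = 0 \<and> \<gamma> = 0"
proof -
  have L: "Lpol x > 0" using assms(1) Lpol_pos by simp
  have B: "B20 x > 0" "B11 x > 0" "B02 x > 0" "B10 x > 0" "B01 x > 0"
    using assms(1) L by (simp_all add: B20_def B11_def B02_def B10_def B01_def add_pos_pos)
  have t: "B20 x * \<beta>\<^sup>2 \<ge> 0" "B11 x * \<beta> * \<gamma> \<ge> 0" "B02 x * \<gamma>\<^sup>2 \<ge> 0"
    "B10 x * \<beta> * (1 - \<beta> - \<gamma>) \<ge> 0" "B01 x * \<gamma> * (1 - \<beta> - \<gamma>) \<ge> 0"
    using B assms by simp_all
  show "Ppol x \<beta> \<gamma> \<ge> 0" using t unfolding Ppol_def Let_def by linarith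
  show "Ppol x \<beta> \<gamma> = 0 \<longleftrightarrow> \<beta> = 0 \<and> \<gamma> = 0"
  proof
    assume "Ppol x \<beta> \<gamma> = 0"
    then have "B20 x * \<beta>\<^sup>2 = 0" "B02 x * \<gamma>\<^sup>2 = 0"
      using t unfolding Ppol_def Let_def by linarith+
    then show "\<beta> = 0 \<and> \<gamma> = 0" using B by simp
  qed (simp add: Ppol_def Let_def)
qed

lemma onb_sequence:
  fixes e :: "nat \<Rightarrow> cayley"
  assumes "\<forall>i\<in>{1..16}. \<forall>j\<in>{1..16}. e i \<bullet> e j = (if i = j then 1 else 0)"
  shows "inj_on e {1..16}" "onb (e ` {1..16})"
proof -
  have same: "e i \<bullet> e i = 1" if "i \<in> {1..16}" for i
    using assms that by simp
  have diff: "e i \<bullet> e j = 0" if "i \<in> {1..16}" "j \<in> {1..16}" "i \<noteq> j" for i j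
    using assms that by simp
  show inj: "inj_on e {1..16}"
  proof (rule inj_onI, rule ccontr)
    fix i j assume ij: "i \<in> {1..16}" "j \<in> {1..16}" "e i = e j" "i \<noteq> j"
    show False using same[OF ij(1)] diff[OF ij(1,2,4)] ij(3) by simp
  qed
  show "onb (e ` {1..16})"
  proof (rule onbI_card)
    show "pairwise orthogonal (e ` {1..16})"
      unfolding pairwise_image
      by (rule pairwiseI) (simp add: orthogonal_def diff)
    fix b assume "b \<in> e ` {1..16}"
    then obtain i where "i \<in> {1..16}" "b = e i" by blast
    then show "norm b = 1" using same[of i] by (simp add: norm_eq_1)
  next
    show "card (e ` {1..16}) = DIM(cayley)"
      using inj by (simp add: card_image)
  qed
qed

text \<open>The sum of \<open>|P e\<^sub>j|\<^sup>2\<close> over an orthonormal basis is the trace of the projection \<open>P\<close>.\<close>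

lemma sum_norm_projections:
  fixes e :: "nat \<Rightarrow> cayley"
  assumes unit: "norm \<theta> = 1"
    and orthonormal: "\<forall>i\<in>{1..16}. \<forall>j\<in>{1..16}. e i \<bullet> e j = (if i = j then 1 else 0)"
  shows "(\<Sum>j=1..16. (norm (Hproj \<theta> (e j)))\<^sup>2) = 8" "(\<Sum>j=1..16. (norm (Vproj \<theta> (e j)))\<^sup>2) = 7"
proof -
  note E = onb_sequence[OF orthonormal]
  have pars: "(\<Sum>j=1..16. (u \<bullet> e j) * (v \<bullet> e j)) = u \<bullet> v" for u v
    using parseval[OF E(2), of u v] by (simp only: sum.reindex[OF E(1)] o_def)
  have tr: "(\<Sum>j=1..16. e j \<bullet> line_proj \<theta> (e j)) = 8"
    using trace_selfadjoint_projection[OF E(2), of "line_proj \<theta>"] line_proj_trace[OF unit]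
    by (simp only: line_proj_selfadjoint line_proj_idem unit sum.reindex[OF E(1)] o_def)
  have one: "(\<Sum>j=1..16. e j \<bullet> e j) = 16" using orthonormal by simp
  have H: "(norm (Hproj \<theta> u))\<^sup>2 = u \<bullet> u - u \<bullet> line_proj \<theta> u" for u
    by (simp add: power2_norm_eq_inner Hproj_selfadjoint HV_compose unit) (simp add: Hproj_def inner_diff_right)
  show "(\<Sum>j=1..16. (norm (Hproj \<theta> (e j)))\<^sup>2) = 8"
    by (simp only: H sum_subtractf tr one)
  have V: "(norm (Vproj \<theta> u))\<^sup>2 = u \<bullet> line_proj \<theta> u - (\<theta> \<bullet> u) * (\<theta> \<bullet> u)" for u
    by (simp add: power2_norm_eq_inner Vproj_selfadjoint HV_compose unit)
       (simp add: Vproj_def inner_diff_right inner_commute)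
  show "(\<Sum>j=1..16. (norm (Vproj \<theta> (e j)))\<^sup>2) = 7"
    by (simp only: V sum_subtractf tr pars theta_sq[OF unit])
qed

theorem theorem2p11:
  fixes e :: "nat \<Rightarrow> cayley"
    and z \<nu> v w :: cayley
    and \<alpha> \<beta> \<gamma> x :: real
  assumes orthonormal: "\<forall>i\<in>{1..16}. \<forall>j\<in>{1..16}. e i \<bullet> e j = (if i = j then 1 else 0)"
    and point: "z \<noteq> 0"
    and unit: "cayley_metric z \<nu> \<nu> = 1"
    and decomp: "\<nu> = \<alpha> *\<^sub>R radial z + v + w" "v \<in> Hsp (sgn z)" "w \<in> Vsp (sgn z)"
    and beta: "\<beta> = cayley_metric z v v"
    and gamma: "\<gamma> = cayley_metric z w w"
    and x: "x = (sinh (norm z))\<^sup>2"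
  shows "trace_T e z \<nu> = - (Ppol x \<beta> \<gamma> / (27225 * (1 + x) ^ 8))
       \<and> trace_T e z \<nu> \<le> 0
       \<and> (trace_T e z \<nu> = 0 \<longleftrightarrow> \<beta> = 0 \<and> \<gamma> = 0)"
proof -
  define r \<theta> where "r = norm z" and "\<theta> = sgn z"
  have r: "r > 0" and \<theta>: "norm \<theta> = 1" and z: "z = r *\<^sub>R \<theta>"
    using point by (simp_all add: r_def \<theta>_def norm_sgn sgn_div_norm)
  have xpos: "x > 0" and cosh: "(cosh r)\<^sup>2 = 1 + x"
    using r by (simp_all add: x r_def[symmetric] cosh_even_powers(1))
  have hv: "Hproj \<theta> v = v" "Vproj \<theta> w = w"
    using decomp(2,3) unfolding \<theta>_def[symmetric] Hsp_iff[OF \<theta>] Vsp_iff[OF \<theta>] by auto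
  have \<nu>: "\<nu> = \<alpha> *\<^sub>R \<theta> + v + w" using decomp(1) by (simp only: radial_def \<theta>_def)
  have coords: "\<nu> \<bullet> \<theta> = \<alpha>" "Hproj \<theta> \<nu> = v" "Vproj \<theta> \<nu> = w"
    unfolding \<nu> by (rule polar_coords[OF \<theta> hv])+
  have perp: "v \<bullet> \<theta> = 0" "w \<bullet> \<theta> = 0" "Vproj \<theta> v = 0" "Hproj \<theta> w = 0" "v \<bullet> w = 0"
    using Hproj_theta(2)[OF \<theta>, of v] Vproj_theta(2)[OF \<theta>, of w] HV_compose(2)[OF \<theta>, of w] HV_compose(3)[OF \<theta>, of v]
      HV_inner(1)[OF \<theta>, of v w] by (simp_all only: hv)
  have \<beta>: "\<beta> = (sinh r / r)\<^sup>2 * (norm v)\<^sup>2" and \<gamma>: "\<gamma> = (sinh r * cosh r / r)\<^sup>2 * (norm w)\<^sup>2"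
    unfolding beta gamma z cayley_metric_polar[OF \<theta> r] hv perp by (simp_all add: power2_norm_eq_inner)
  have one: "\<alpha>\<^sup>2 + \<beta> + \<gamma> = 1"
    using unit unfolding z cayley_metric_polar[OF \<theta> r] coords
    by (simp only: \<beta> \<gamma> power2_norm_eq_inner power2_eq_square[of \<alpha>])
  define k where "k = radial_speed r"
  define S where "S = \<alpha>\<^sup>2 * rateN x + \<beta> * rateH x + \<gamma> * rateV x"
  define A where "A = \<alpha>\<^sup>2 * ((rateN x)\<^sup>2 + rateN' x * Xspeed x)
    + \<beta> * ((rateH x)\<^sup>2 + rateH' x * Xspeed x) + \<gamma> * ((rateV x)\<^sup>2 + rateV' x * Xspeed x)"
  \<comment> \<open>The linear coefficients from the cross terms with the gradient of \<open>\<phi>\<^sub>j\<close> are \<open>\<kappa>\<close> times the inner products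
    of \<open>v\<close> and of \<open>w\<close> with \<open>e j\<close>.\<close>
  define \<kappa> where "\<kappa> = - 2 * \<alpha> * k / r"
  define K where "K = (Lpol x)\<^sup>2 / (27225 * (1 + x) ^ 7)"
  have K: "k\<^sup>2 / x = K"
  proof -
    have "k\<^sup>2 = x * (Lpol x)\<^sup>2 / (165\<^sup>2 * ((cosh r)\<^sup>2) ^ 7)"
      by (simp add: k_def radial_speed_def x r_def[symmetric] power_divide power_mult_distrib flip: power_mult)
    then show ?thesis using xpos by (simp add: K_def cosh)
  qed
  have K': "k\<^sup>2 / (x * (1 + x)) = K / (1 + x)" by (simp add: K[symmetric])
  \<comment> \<open>The Jacobian's derivatives for an arbitrary affine function, in the notation fixed above.\<close>
  note jets = jac_jet2[OF \<theta> r, of \<nu>, unfolded coords, folded \<beta> \<gamma>, OF one,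
      folded x[folded r_def], folded S_def A_def k_def, folded \<kappa>_def]
  have J1: "deriv (jac z \<nu> (\<lambda>_. 1)) 0 = S / 2"
    using jets(1)[of 0 1] by (simp add: z)
  have J2: "deriv (deriv (jac z \<nu> (\<lambda>\<omega>. \<omega> \<bullet> e j))) 0 =
      ((\<theta> \<bullet> e j) * (\<theta> \<bullet> e j) * A + 2 * \<kappa> * (rateH x * ((\<theta> \<bullet> e j) * (v \<bullet> e j)) + rateV x * ((\<theta> \<bullet> e j) * (w \<bullet> e j)))
        + 2 * (\<alpha>\<^sup>2 * K * (norm (Hproj \<theta> (e j)))\<^sup>2 + \<alpha>\<^sup>2 * (K / (1 + x)) * (norm (Vproj \<theta> (e j)))\<^sup>2)) / 2
      - ((\<theta> \<bullet> e j) * (\<theta> \<bullet> e j) * S\<^sup>2 + 2 * S * \<kappa> * ((\<theta> \<bullet> e j) * ((v + w) \<bullet> e j))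
         + \<kappa>\<^sup>2 * (((v + w) \<bullet> e j) * ((v + w) \<bullet> e j))) / 4" for j
    using jets(2)[of "e j" 0]
    by (simp add: z K[symmetric] K'[symmetric] power2_eq_square inner_add_left algebra_simps)
  note E = onb_sequence[OF orthonormal]
  have pars: "(\<Sum>j=1..16. (u \<bullet> e j) * (u' \<bullet> e j)) = u \<bullet> u'" for u u'
    using parseval[OF E(2), of u u'] by (simp only: sum.reindex[OF E(1)] o_def)
  have \<theta>_perp: "\<theta> \<bullet> v = 0" "\<theta> \<bullet> w = 0" "\<theta> \<bullet> (v + w) = 0"
    using perp(1,2) by (simp_all add: inner_add_right inner_commute[of \<theta> v] inner_commute[of \<theta> w])
  have \<kappa>vw: "\<kappa>\<^sup>2 * ((v + w) \<bullet> (v + w)) = 4 * \<alpha>\<^sup>2 * (K * \<beta> + K / (1 + x) * \<gamma>)"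
  proof -
    have \<beta>': "\<beta> = x / r\<^sup>2 * (v \<bullet> v)" and \<gamma>': "\<gamma> = x * (1 + x) / r\<^sup>2 * (w \<bullet> w)"
      by (simp_all add: \<beta> \<gamma> x r_def[symmetric] power2_norm_eq_inner power_divide power_mult_distrib
          cosh_even_powers(1))
    have cancel: "k\<^sup>2 / y * (y / r\<^sup>2 * d) = k\<^sup>2 / r\<^sup>2 * d" if "y \<noteq> 0" for y d
      using that by simp
    have K\<beta>: "K * \<beta> = k\<^sup>2 / r\<^sup>2 * (v \<bullet> v)"
      unfolding K[symmetric] \<beta>' by (rule cancel) (use xpos in simp)
    have K\<gamma>: "K / (1 + x) * \<gamma> = k\<^sup>2 / r\<^sup>2 * (w \<bullet> w)"
      unfolding K'[symmetric] \<gamma>' by (rule cancel) (use xpos in simp)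
    have \<kappa>: "\<kappa>\<^sup>2 = 4 * \<alpha>\<^sup>2 * (k\<^sup>2 / r\<^sup>2)"
      by (simp add: \<kappa>_def power_divide power_mult_distrib)
    have vw: "(v + w) \<bullet> (v + w) = v \<bullet> v + w \<bullet> w"
      using perp(5) by (simp add: inner_add_left inner_add_right inner_commute[of w v])
    show ?thesis
      unfolding K\<beta> K\<gamma> \<kappa> vw by (simp only: distrib_left mult.assoc)
  qed
  have "(\<Sum>j=1..16. deriv (deriv (jac z \<nu> (\<lambda>\<omega>. \<omega> \<bullet> e j))) 0) =
      (A + 2 * (\<alpha>\<^sup>2 * K * 8 + \<alpha>\<^sup>2 * (K / (1 + x)) * 7)) / 2
      - (S\<^sup>2 + 4 * \<alpha>\<^sup>2 * (K * \<beta> + K / (1 + x) * \<gamma>)) / 4"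
    unfolding J2 sum_subtractf sum_divide_distrib[symmetric] sum.distrib sum_distrib_left[symmetric]
      sum_distrib_right[symmetric] pars sum_norm_projections[OF \<theta> orthonormal]
      theta_sq[OF \<theta>] \<theta>_perp \<kappa>vw by simp
  then have T: "trace_T e z \<nu> = (A + 2 * (\<alpha>\<^sup>2 * K * 8 + \<alpha>\<^sup>2 * (K / (1 + x)) * 7)) / 2
      - (S\<^sup>2 + 4 * \<alpha>\<^sup>2 * (K * \<beta> + K / (1 + x) * \<gamma>)) / 4 - 8 * S"
    by (simp add: trace_T_def J1)
  have \<alpha>: "\<alpha>\<^sup>2 = 1 - \<beta> - \<gamma>" using one by simp
  have eq: "trace_T e z \<nu> = - (Ppol x \<beta> \<gamma> / (27225 * (1 + x) ^ 8))"
    unfolding T A_def S_def K_def \<alpha> by (rule trace_rational_identity[OF less_imp_le[OF xpos]])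
  have "\<beta> \<ge> 0" "\<gamma> \<ge> 0" by (simp_all add: \<beta> \<gamma>)
  moreover from one have "\<beta> + \<gamma> \<le> 1" using zero_le_power2[of \<alpha>] by linarith
  ultimately have "Ppol x \<beta> \<gamma> \<ge> 0" "Ppol x \<beta> \<gamma> = 0 \<longleftrightarrow> \<beta> = 0 \<and> \<gamma> = 0"
    using Ppol_sign[OF xpos] by blast+
  then show ?thesis unfolding eq using xpos by simp
qed

end
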